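(* Let $N\ge1$ be an integer. (i) Suppose $1<p<2$. Then $S_p:C^0[0,1]\to B_p$ is $C^1$, and for all $h,\bar h\in C^0[0,1]$, $$DS_p(h)\bar h=p^*\,\mathcal{I}\big(|u(h)'|^{2-p}J(\bar h)\big),\qquad(\ast)$$ where $u(h)=S_p(h)$. Furthermore, if $v=DS_p(h)\bar h$, then $v\in B_p$ and $$-(r^{N-1}|u(h)'(r)|^{p-2}v'(r))'=p^*r^{N-1}\bar h(r),\qquad v'(0)=v(1)=0.\qquad(\ast\ast)$$ (ii) Suppose $p>2$ and let $h_0\in C^0[0,1]$ be such that, for $r\in[0,1]$, $u(h_0)'(r)=0$ implies $h_0(r)\ne0$. Then there exists a neighbourhood $V_0$ of $h_0$ in $C^0[0,1]$ such that the mapping $h\mapsto|u(h)'|^{2-p}:V_0\to L^1(0,1)$ is continuous, $S_p:V_0\to B_p$ is $C^1$, and for all $h\in V_0$, $\bar h\in C^0[0,1]$, the derivative $DS_p(h)\bar h$ is given by $(\ast)$, and $v=DS_p(h)\bar h$ satisfies $v\in B_p$ and $(\ast\ast)$.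
   Context: For $q>1$, $\phi_q(\xi):=|\xi|^{q-2}\xi$ for $\xi\in\mathbb{R}$ (with $\phi_q(0)=0$). For $p>1$, $p^*:=1/(p-1)$ and $p':=p/(p-1)=p^*+1$. $B_p:=C^1[0,1]$ if $1<p\le2$ and $B_p:=W^{1,1}(0,1)$ if $p>2$. Define $J(h)(s):=\int_0^s(t/s)^{N-1}h(t)\,\mathrm{d}t$ (equal to $0$ at $s=0$), $\mathcal{I}(k)(r):=\int_r^1k(s)\,\mathrm{d}s$, and $$S_p(h)(r):=\int_r^1\phi_{p'}\left(\int_0^s\left(\frac{t}{s}\right)^{N-1}h(t)\,\mathrm{d}t\right)\mathrm{d}s,\qquad h\in C^0[0,1],\ r\in[0,1].$$ $u(h):=S_p(h)$ is the unique solution in $\{u\in C^1[0,1]:\phi_p(u')\in C^1[0,1],\ u'(0)=u(1)=0\}$ of $-(r^{N-1}\phi_p(u'))'=r^{N-1}h(r)$, $0<r<1$, $u'(0)=u(1)=0$. $C^1$ means continuously Fréchet differentiable, with derivative $DS_p$. *)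

theory Defs
  imports "HOL-Analysis.Analysis"
begin

typedef unit_interval = "{0..1::real}"
  by (rule exI[of _ 0]) simp

setup_lifting type_definition_unit_interval

instantiation unit_interval :: metric_space
begin

lift_definition dist_unit_interval :: "unit_interval \<Rightarrow> unit_interval \<Rightarrow> real" is dist .

definition uniformity_unit_interval :: "(unit_interval \<times> unit_interval) filter" where
  "uniformity_unit_interval = (INF e\<in>{0<..}. principal {(x, y). dist x y < e})"

definition open_unit_interval :: "unit_interval set \<Rightarrow> bool" where
  "open_unit_interval U =
     (\<forall>x\<in>U. eventually (\<lambda>(x', y). x' = x \<longrightarrow> y \<in> U) uniformity)"

instance
proof
  fix x y z :: unit_interval
  show "dist x y = 0 \<longleftrightarrow> x = y" by transfer simp
  show "dist x y \<le> dist x z + dist y z" by transfer (rule dist_triangle2)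
qed (simp_all add: uniformity_unit_interval_def open_unit_interval_def)

end

type_synonym C0 = "unit_interval \<Rightarrow>\<^sub>C real"

text \<open>An element of C0 as a function on the line; arguments outside the interval
  are projected to its nearest point.\<close>

definition C0_fun :: "C0 \<Rightarrow> real \<Rightarrow> real" where
  "C0_fun h r = apply_bcontfun h (Abs_unit_interval (max 0 (min 1 r)))"

lemma C0_fun_zero [simp]: "C0_fun 0 r = 0"
  and C0_fun_add [simp]: "C0_fun (h + k) r = C0_fun h r + C0_fun k r"
  and C0_fun_minus [simp]: "C0_fun (h - k) r = C0_fun h r - C0_fun k r"
  and C0_fun_uminus [simp]: "C0_fun (- h) r = - C0_fun h r"
  and C0_fun_scaleR [simp]: "C0_fun (c *\<^sub>R h) r = c * C0_fun h r"
  by (simp_all add: C0_fun_def)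

lemma C0_fun_Rep [simp]: "C0_fun h (Rep_unit_interval x) = apply_bcontfun h x"
proof -
  have "max 0 (min 1 (Rep_unit_interval x)) = Rep_unit_interval x"
    using Rep_unit_interval[of x] by auto
  then show ?thesis by (simp add: C0_fun_def Rep_unit_interval_inverse)
qed

lemma C0_eqI:
  assumes "\<And>r. r \<in> {0..1} \<Longrightarrow> C0_fun h r = C0_fun k r"
  shows "h = k"
proof (rule bcontfun_eqI)
  fix x
  show "apply_bcontfun h x = apply_bcontfun k x"
    using assms[OF Rep_unit_interval[of x]] by simp
qed

lemma continuous_on_Rep_unit_interval: "continuous_on S Rep_unit_interval"
  unfolding continuous_on_iff by (metis dist_unit_interval.rep_eq)

lemma continuous_on_C0_fun: "continuous_on S (C0_fun h)"
proof -
  let ?P = "\<lambda>r. Abs_unit_interval (max 0 (min 1 r))"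
  have "dist (?P r) (?P s) \<le> dist r s" for r s :: real
    by (simp add: dist_unit_interval.rep_eq Abs_unit_interval_inverse dist_real_def)
  then have "continuous_on S ?P"
    unfolding continuous_on_iff by (meson order_le_less_trans)
  moreover have "continuous_on UNIV (apply_bcontfun h)"
    using apply_bcontfun[of h] by (auto simp: bcontfun_def)
  ultimately have "continuous_on S (apply_bcontfun h \<circ> ?P)"
    by (meson continuous_on_compose continuous_on_subset subset_UNIV)
  moreover have "apply_bcontfun h \<circ> ?P = C0_fun h"
    by (rule ext) (simp add: C0_fun_def)
  ultimately show ?thesis by simp
qed

lemma C0_of_continuous_on:
  fixes f :: "real \<Rightarrow> real"
  assumes "continuous_on {0..1} f"
  obtains h where "\<And>r. r \<in> {0..1} \<Longrightarrow> C0_fun h r = f r"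
proof -
  have range: "range Rep_unit_interval \<subseteq> {0..1}"
    using Rep_unit_interval by auto
  have cont: "continuous_on UNIV (f \<circ> Rep_unit_interval)"
    by (rule continuous_on_compose[OF continuous_on_Rep_unit_interval
          continuous_on_subset[OF assms range]])
  have "compact (f ` {0..1})"
    by (rule compact_continuous_image[OF assms]) simp
  then have "bounded (f ` {0..1})"
    by (rule compact_imp_bounded)
  then have "bounded (range (f \<circ> Rep_unit_interval))"
    by (rule bounded_subset) (use range in auto)
  with cont have b: "f \<circ> Rep_unit_interval \<in> bcontfun"
    by (simp add: bcontfun_def)
  show ?thesis
  proof (rule that[of "Bcontfun (f \<circ> Rep_unit_interval)"])
    fix r :: real
    assume "r \<in> {0..1}"
    then show "C0_fun (Bcontfun (f \<circ> Rep_unit_interval)) r = f r"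
      by (auto simp: C0_fun_def Bcontfun_inverse[OF b] Abs_unit_interval_inverse)
  qed
qed

definition C0_has_deriv :: "C0 \<Rightarrow> C0 \<Rightarrow> bool" where
  "C0_has_deriv u u' \<longleftrightarrow>
     (\<forall>r\<in>{0..1}. (C0_fun u has_real_derivative C0_fun u' r) (at r within {0..1}))"

definition C0_deriv :: "C0 \<Rightarrow> C0" where
  "C0_deriv u = (THE u'. C0_has_deriv u u')"

lemma C0_has_deriv_unique:
  assumes "C0_has_deriv u v" "C0_has_deriv u w"
  shows "v = w"
proof (rule C0_eqI)
  fix r :: real
  assume r: "r \<in> {0..1}"
  show "C0_fun v r = C0_fun w r"
    using assms r vector_derivative_unique_within_closed_interval[of 0 1 r "C0_fun u"]
    by (auto simp: C0_has_deriv_def has_real_derivative_iff_has_vector_derivative)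
qed

lemma C0_deriv_eq: "C0_has_deriv u v \<Longrightarrow> C0_deriv u = v"
  unfolding C0_deriv_def using C0_has_deriv_unique by blast

lemma C0_has_deriv_zero: "C0_has_deriv 0 0"
proof -
  have "C0_fun 0 = (\<lambda>r. 0)" by (rule ext) simp
  then show ?thesis by (simp add: C0_has_deriv_def)
qed

lemma C0_has_deriv_add:
  assumes "C0_has_deriv u v" "C0_has_deriv u2 v2"
  shows "C0_has_deriv (u + u2) (v + v2)"
proof -
  have "C0_fun (u + u2) = (\<lambda>r. C0_fun u r + C0_fun u2 r)" by (rule ext) simp
  with assms show ?thesis by (auto simp: C0_has_deriv_def intro!: DERIV_add)
qed

lemma C0_has_deriv_scaleR:
  assumes "C0_has_deriv u v"
  shows "C0_has_deriv (c *\<^sub>R u) (c *\<^sub>R v)"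
proof -
  have "C0_fun (c *\<^sub>R u) = (\<lambda>r. c * C0_fun u r)" by (rule ext) simp
  with assms show ?thesis by (auto simp: C0_has_deriv_def intro!: DERIV_cmult)
qed

lemma C0_has_deriv_uminus:
  assumes "C0_has_deriv u v"
  shows "C0_has_deriv (- u) (- v)"
  using C0_has_deriv_scaleR[OF assms, of "- 1"] by simp

lemma C0_has_deriv_minus:
  assumes "C0_has_deriv u v" "C0_has_deriv u2 v2"
  shows "C0_has_deriv (u - u2) (v - v2)"
  using C0_has_deriv_add[OF assms(1) C0_has_deriv_uminus[OF assms(2)]] by simp

typedef C1 = "{u. \<exists>u'. C0_has_deriv u u'}"
  using C0_has_deriv_zero by blast

setup_lifting type_definition_C1

lift_definition C1_deriv :: "C1 \<Rightarrow> C0" is C0_deriv .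

lemma C1_deriv: "C0_has_deriv (Rep_C1 u) (C1_deriv u)"
  using Rep_C1[of u] by (auto simp: C1_deriv.rep_eq C0_deriv_eq)

instantiation C1 :: real_vector
begin

lift_definition zero_C1 :: C1 is 0 using C0_has_deriv_zero by blast
lift_definition plus_C1 :: "C1 \<Rightarrow> C1 \<Rightarrow> C1" is "(+)" using C0_has_deriv_add by blast
lift_definition minus_C1 :: "C1 \<Rightarrow> C1 \<Rightarrow> C1" is "(-)" using C0_has_deriv_minus by blast
lift_definition uminus_C1 :: "C1 \<Rightarrow> C1" is uminus using C0_has_deriv_uminus by blast
lift_definition scaleR_C1 :: "real \<Rightarrow> C1 \<Rightarrow> C1" is scaleR using C0_has_deriv_scaleR by blast

instance
proof
  fix u v w :: C1 and a b :: real
  show "u + v + w = u + (v + w)" by transfer (simp add: algebra_simps)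
  show "u + v = v + u" by transfer (simp add: algebra_simps)
  show "0 + u = u" by transfer simp
  show "- u + u = 0" by transfer simp
  show "u - v = u + - v" by transfer simp
  show "a *\<^sub>R (u + v) = a *\<^sub>R u + a *\<^sub>R v" by transfer (simp add: algebra_simps)
  show "(a + b) *\<^sub>R u = a *\<^sub>R u + b *\<^sub>R u" by transfer (simp add: algebra_simps)
  show "a *\<^sub>R b *\<^sub>R u = (a * b) *\<^sub>R u" by transfer simp
  show "1 *\<^sub>R u = u" by transfer simp
qed

end

lemma C1_deriv_add: "C1_deriv (u + v) = C1_deriv u + C1_deriv v"
  unfolding C1_deriv.rep_eq plus_C1.rep_eq
  using C1_deriv[of u] C1_deriv[of v] by (metis C0_deriv_eq C0_has_deriv_add)

lemma C1_deriv_scaleR: "C1_deriv (c *\<^sub>R u) = c *\<^sub>R C1_deriv u"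
  unfolding C1_deriv.rep_eq scaleR_C1.rep_eq
  using C1_deriv[of u] by (metis C0_deriv_eq C0_has_deriv_scaleR)

lemma C1_deriv_zero: "C1_deriv 0 = 0"
  by (simp add: C1_deriv.rep_eq zero_C1.rep_eq C0_deriv_eq C0_has_deriv_zero)

instantiation C1 :: real_normed_vector
begin

definition norm_C1 :: "C1 \<Rightarrow> real" where
  "norm_C1 u = norm (Rep_C1 u) + norm (C1_deriv u)"

definition dist_C1 :: "C1 \<Rightarrow> C1 \<Rightarrow> real" where
  "dist_C1 u v = norm (u - v)"

definition sgn_C1 :: "C1 \<Rightarrow> C1" where
  "sgn_C1 u = u /\<^sub>R norm u"

definition uniformity_C1 :: "(C1 \<times> C1) filter" where
  "uniformity_C1 = (INF e\<in>{0<..}. principal {(x, y). dist x y < e})"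

definition open_C1 :: "C1 set \<Rightarrow> bool" where
  "open_C1 U = (\<forall>x\<in>U. eventually (\<lambda>(x', y). x' = x \<longrightarrow> y \<in> U) uniformity)"

instance
proof
  fix u v w :: C1 and a b :: real
  show "norm u = 0 \<longleftrightarrow> u = 0"
    using C1_deriv_zero
    by (metis Rep_C1_inject add.right_neutral add_nonneg_eq_0_iff norm_C1_def norm_ge_zero
        norm_zero norm_eq_zero zero_C1.rep_eq)
  show "norm (u + v) \<le> norm u + norm v"
    unfolding norm_C1_def C1_deriv_add plus_C1.rep_eq
    using norm_triangle_ineq[of "Rep_C1 u" "Rep_C1 v"]
      norm_triangle_ineq[of "C1_deriv u" "C1_deriv v"] by linarith
  show "norm (a *\<^sub>R u) = \<bar>a\<bar> * norm u"
    by (simp add: norm_C1_def C1_deriv_scaleR scaleR_C1.rep_eq distrib_left)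
qed (simp_all add: dist_C1_def sgn_C1_def uniformity_C1_def open_C1_def)

end

definition C1_fun :: "C1 \<Rightarrow> real \<Rightarrow> real" where
  "C1_fun u = C0_fun (Rep_C1 u)"

abbreviation lebesgue01 :: "real measure" where
  "lebesgue01 \<equiv> lebesgue_on {0<..<1}"

definition L1_rel :: "(real \<Rightarrow> real) \<Rightarrow> (real \<Rightarrow> real) \<Rightarrow> bool" where
  "L1_rel f g \<longleftrightarrow>
     integrable lebesgue01 f \<and> integrable lebesgue01 g \<and> (AE x in lebesgue01. f x = g x)"

lemma L1_rel_refl: "L1_rel f f \<longleftrightarrow> integrable lebesgue01 f"
  by (simp add: L1_rel_def)

lemma part_equivp_L1_rel: "part_equivp L1_rel"
proof (rule part_equivpI)
  show "\<exists>f. L1_rel f f"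
    by (rule exI[of _ "\<lambda>_. 0"]) (simp add: L1_rel_def)
  show "symp L1_rel"
    by (rule sympI) (auto simp: L1_rel_def eq_commute)
  show "transp L1_rel"
  proof (rule transpI)
    fix f g h assume "L1_rel f g" "L1_rel g h"
    then show "L1_rel f h"
      unfolding L1_rel_def by (auto elim: eventually_elim2)
  qed
qed

quotient_type L1 = "real \<Rightarrow> real" / partial: L1_rel
  by (rule part_equivp_L1_rel)

instantiation L1 :: real_vector
begin

lift_definition zero_L1 :: L1 is "\<lambda>_. 0"
  by (simp add: L1_rel_def)

lift_definition plus_L1 :: "L1 \<Rightarrow> L1 \<Rightarrow> L1" is "\<lambda>f g x. f x + g x"
  unfolding L1_rel_def by (auto elim: eventually_elim2)

lift_definition minus_L1 :: "L1 \<Rightarrow> L1 \<Rightarrow> L1" is "\<lambda>f g x. f x - g x"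
  unfolding L1_rel_def by (auto elim: eventually_elim2)

lift_definition uminus_L1 :: "L1 \<Rightarrow> L1" is "\<lambda>f x. - f x"
  unfolding L1_rel_def by auto

lift_definition scaleR_L1 :: "real \<Rightarrow> L1 \<Rightarrow> L1" is "\<lambda>c f x. c * f x"
  unfolding L1_rel_def by (auto elim: eventually_mono)

instance
proof
  fix u v w :: L1 and a b :: real
  show "u + v + w = u + (v + w)" by transfer (simp add: L1_rel_def algebra_simps)
  show "u + v = v + u" by transfer (simp add: L1_rel_def algebra_simps)
  show "0 + u = u" by transfer (simp add: L1_rel_def)
  show "- u + u = 0" by transfer (simp add: L1_rel_def)
  show "u - v = u + - v" by transfer (simp add: L1_rel_def)
  show "a *\<^sub>R (u + v) = a *\<^sub>R u + a *\<^sub>R v" by transfer (simp add: L1_rel_def algebra_simps)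
  show "(a + b) *\<^sub>R u = a *\<^sub>R u + b *\<^sub>R u" by transfer (simp add: L1_rel_def algebra_simps)
  show "a *\<^sub>R b *\<^sub>R u = (a * b) *\<^sub>R u" by transfer (simp add: L1_rel_def algebra_simps)
  show "1 *\<^sub>R u = u" by transfer (simp add: L1_rel_def)
qed

end

instantiation L1 :: real_normed_vector
begin

lift_definition norm_L1 :: "L1 \<Rightarrow> real" is "\<lambda>f. LINT x|lebesgue01. \<bar>f x\<bar>"
  unfolding L1_rel_def by (rule integral_cong_AE) (auto elim: eventually_mono)

definition dist_L1 :: "L1 \<Rightarrow> L1 \<Rightarrow> real" where
  "dist_L1 u v = norm (u - v)"

definition sgn_L1 :: "L1 \<Rightarrow> L1" where
  "sgn_L1 u = u /\<^sub>R norm u"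

definition uniformity_L1 :: "(L1 \<times> L1) filter" where
  "uniformity_L1 = (INF e\<in>{0<..}. principal {(x, y). dist x y < e})"

definition open_L1 :: "L1 set \<Rightarrow> bool" where
  "open_L1 U = (\<forall>x\<in>U. eventually (\<lambda>(x', y). x' = x \<longrightarrow> y \<in> U) uniformity)"

instance
proof
  fix u v w :: L1 and a b :: real
  show "norm u = 0 \<longleftrightarrow> u = 0"
    by transfer (simp add: L1_rel_def integral_nonneg_eq_0_iff_AE)
  show "norm (u + v) \<le> norm u + norm v"
  proof transfer
    fix f g assume "L1_rel f f" "L1_rel g g"
    then have [simp]: "integrable lebesgue01 f" "integrable lebesgue01 g"
      by (simp_all add: L1_rel_def)
    have "(LINT x|lebesgue01. \<bar>f x + g x\<bar>) \<le> (LINT x|lebesgue01. \<bar>f x\<bar> + \<bar>g x\<bar>)"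
      by (rule integral_mono) auto
    then show "(LINT x|lebesgue01. \<bar>f x + g x\<bar>)
        \<le> (LINT x|lebesgue01. \<bar>f x\<bar>) + (LINT x|lebesgue01. \<bar>g x\<bar>)"
      by simp
  qed
  show "norm (a *\<^sub>R u) = \<bar>a\<bar> * norm u"
    by transfer (simp add: abs_mult)
qed (simp_all add: dist_L1_def sgn_L1_def uniformity_L1_def open_L1_def)

end

definition represents_L1 :: "(real \<Rightarrow> real) \<Rightarrow> L1 \<Rightarrow> bool" where
  "represents_L1 f u \<longleftrightarrow> integrable lebesgue01 f \<and> abs_L1 f = u"

lemma represents_L1_rep: "represents_L1 (rep_L1 u) u"
  unfolding represents_L1_def
  by (metis L1_rel_refl Quotient_L1 Quotient_abs_rep Quotient_rep_reflp)

lemma represents_L1_iff: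
  "represents_L1 f u \<longleftrightarrow>
     integrable lebesgue01 f \<and> (AE x in lebesgue01. f x = rep_L1 u x)"
proof -
  have *: "integrable lebesgue01 (rep_L1 u)" "abs_L1 (rep_L1 u) = u"
    using represents_L1_rep[of u] by (simp_all add: represents_L1_def)
  have "L1_rel f (rep_L1 u) \<longleftrightarrow> L1_rel f f \<and> L1_rel (rep_L1 u) (rep_L1 u)
      \<and> abs_L1 f = abs_L1 (rep_L1 u)"
    using Quotient_rel[OF Quotient_L1] by metis
  with * show ?thesis
    by (auto simp: L1_rel_refl represents_L1_def L1_rel_def)
qed

lemma represents_L1_AE: "represents_L1 f u \<Longrightarrow> AE x in lebesgue01. rep_L1 u x = f x"
  unfolding represents_L1_iff by (auto elim: eventually_mono)

lemma integrable_rep_L1: "integrable lebesgue01 (rep_L1 u)"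
  using represents_L1_rep[of u] by (simp add: represents_L1_def)

lemma rep_L1_zero: "AE x in lebesgue01. rep_L1 0 x = 0"
  and rep_L1_add: "AE x in lebesgue01. rep_L1 (u + v) x = rep_L1 u x + rep_L1 v x"
  and rep_L1_scaleR: "AE x in lebesgue01. rep_L1 (c *\<^sub>R u) x = c * rep_L1 u x"
proof -
  have eq: "abs_L1 (rep_L1 w) = w" for w
    using represents_L1_rep[of w] by (simp add: represents_L1_def)
  have "represents_L1 (\<lambda>_. 0) 0"
    by (simp add: represents_L1_def zero_L1_def)
  then show "AE x in lebesgue01. rep_L1 0 x = 0"
    by (rule represents_L1_AE)
  have "represents_L1 (\<lambda>x. rep_L1 u x + rep_L1 v x) (u + v)"
    using plus_L1.abs_eq[of "rep_L1 u" "rep_L1 v"]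
    by (simp add: represents_L1_def integrable_rep_L1 eq L1_rel_refl)
  then show "AE x in lebesgue01. rep_L1 (u + v) x = rep_L1 u x + rep_L1 v x"
    by (rule represents_L1_AE)
  have "represents_L1 (\<lambda>x. c * rep_L1 u x) (c *\<^sub>R u)"
    using scaleR_L1.abs_eq[of "rep_L1 u" c]
    by (simp add: represents_L1_def integrable_rep_L1 eq L1_rel_refl)
  then show "AE x in lebesgue01. rep_L1 (c *\<^sub>R u) x = c * rep_L1 u x"
    by (rule represents_L1_AE)
qed

lemma L1_eqI: "AE x in lebesgue01. rep_L1 u x = rep_L1 v x \<Longrightarrow> u = v"
  using represents_L1_iff[of "rep_L1 u" v] integrable_rep_L1[of u] represents_L1_rep[of u]
  by (simp add: represents_L1_def)

text \<open>Test functions are taken in $C_c^1(0,1)$; \<open>\<phi>'\<close> is the derivative of \<open>\<phi>\<close>.\<close>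

definition test_function :: "(real \<Rightarrow> real) \<Rightarrow> (real \<Rightarrow> real) \<Rightarrow> bool" where
  "test_function \<phi> \<phi>' \<longleftrightarrow>
     (\<forall>x. (\<phi> has_real_derivative \<phi>' x) (at x)) \<and> continuous_on UNIV \<phi>' \<and>
     closure {x. \<phi> x \<noteq> 0} \<subseteq> {0<..<1}"

definition weak_deriv :: "L1 \<Rightarrow> L1 \<Rightarrow> bool" where
  "weak_deriv u g \<longleftrightarrow> (\<forall>\<phi> \<phi>'. test_function \<phi> \<phi>' \<longrightarrow>
     (LINT x|lebesgue01. rep_L1 u x * \<phi>' x) = - (LINT x|lebesgue01. rep_L1 g x * \<phi> x))"

lemma integrable_mult_continuous:
  fixes f \<phi> :: "real \<Rightarrow> real"
  assumes f: "integrable lebesgue01 f" and \<phi>: "continuous_on UNIV \<phi>"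
  shows "integrable lebesgue01 (\<lambda>x. f x * \<phi> x)"
proof -
  have "compact (\<phi> ` {0..1})"
    by (rule compact_continuous_image) (use \<phi> continuous_on_subset in auto)
  then obtain B where B: "\<And>x. x \<in> {0..1} \<Longrightarrow> \<bar>\<phi> x\<bar> \<le> B"
    using compact_imp_bounded bounded_iff by (metis imageI real_norm_def)
  have m: "\<phi> \<in> borel_measurable lebesgue01"
    by (rule measurable_restrict_space1, rule measurable_completion)
      (use borel_measurable_continuous_onI[OF \<phi>] in simp)
  show ?thesis
  proof (rule Bochner_Integration.integrable_bound)
    show "integrable lebesgue01 (\<lambda>x. B * f x)" using f by simp
    show "(\<lambda>x. f x * \<phi> x) \<in> borel_measurable lebesgue01"
      using f m by (intro borel_measurable_times) auto
    show "AE x in lebesgue01. norm (f x * \<phi> x) \<le> norm (B * f x)"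
    proof (rule AE_I2)
      fix x assume "x \<in> space lebesgue01"
      then have x: "x \<in> {0..1}" by auto
      have "0 \<le> B" using B[OF x] by linarith
      then show "norm (f x * \<phi> x) \<le> norm (B * f x)"
        using B[OF x] mult_right_mono[of "\<bar>\<phi> x\<bar>" B "\<bar>f x\<bar>"] by (simp add: abs_mult mult.commute)
    qed
  qed
qed

lemma test_function_continuous:
  assumes "test_function \<phi> \<phi>'"
  shows "continuous_on UNIV \<phi>" "continuous_on UNIV \<phi>'"
  using assms by (auto simp: test_function_def intro: DERIV_continuous_on)

lemma weak_deriv_zero: "weak_deriv 0 0"
proof -
  have "(LINT x|lebesgue01. rep_L1 0 x * \<phi> x) = 0" for \<phi>
    by (rule integral_eq_zero_AE) (use rep_L1_zero in \<open>auto elim: eventually_mono\<close>)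
  then show ?thesis by (simp add: weak_deriv_def)
qed

lemma LINT_rep_L1_add:
  assumes "continuous_on UNIV \<phi>"
  shows "(LINT x|lebesgue01. rep_L1 (u + v) x * \<phi> x) =
    (LINT x|lebesgue01. rep_L1 u x * \<phi> x) + (LINT x|lebesgue01. rep_L1 v x * \<phi> x)"
proof -
  note [simp] = integrable_mult_continuous[OF integrable_rep_L1 assms]
  have "(LINT x|lebesgue01. rep_L1 (u + v) x * \<phi> x) =
      (LINT x|lebesgue01. rep_L1 u x * \<phi> x + rep_L1 v x * \<phi> x)"
  proof (rule integral_cong_AE)
    show "AE x in lebesgue01. rep_L1 (u + v) x * \<phi> x = rep_L1 u x * \<phi> x + rep_L1 v x * \<phi> x"
      by (rule eventually_mono[OF rep_L1_add[of u v]]) (simp add: algebra_simps)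
  qed (simp_all add: borel_measurable_integrable)
  then show ?thesis by simp
qed

lemma LINT_rep_L1_scaleR:
  assumes "continuous_on UNIV \<phi>"
  shows "(LINT x|lebesgue01. rep_L1 (c *\<^sub>R u) x * \<phi> x) =
    c * (LINT x|lebesgue01. rep_L1 u x * \<phi> x)"
proof -
  note [simp] = integrable_mult_continuous[OF integrable_rep_L1 assms]
  have "(LINT x|lebesgue01. rep_L1 (c *\<^sub>R u) x * \<phi> x) =
      (LINT x|lebesgue01. c * (rep_L1 u x * \<phi> x))"
  proof (rule integral_cong_AE)
    show "AE x in lebesgue01. rep_L1 (c *\<^sub>R u) x * \<phi> x = c * (rep_L1 u x * \<phi> x)"
      by (rule eventually_mono[OF rep_L1_scaleR[of c u]]) simp
  qed (simp_all add: borel_measurable_integrable)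
  then show ?thesis by simp
qed

lemma weak_deriv_add:
  "weak_deriv u g \<Longrightarrow> weak_deriv v k \<Longrightarrow> weak_deriv (u + v) (g + k)"
  by (simp add: weak_deriv_def LINT_rep_L1_add test_function_continuous)

lemma weak_deriv_scaleR: "weak_deriv u g \<Longrightarrow> weak_deriv (c *\<^sub>R u) (c *\<^sub>R g)"
  by (simp add: weak_deriv_def LINT_rep_L1_scaleR test_function_continuous)

lemma weak_deriv_uminus: "weak_deriv u g \<Longrightarrow> weak_deriv (- u) (- g)"
  using weak_deriv_scaleR[of u g "- 1"] by simp

lemma weak_deriv_minus:
  assumes "weak_deriv u g" "weak_deriv v k"
  shows "weak_deriv (u - v) (g - k)"
  using weak_deriv_add[OF assms(1) weak_deriv_uminus[OF assms(2)]] by simp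

lemma has_real_derivative_max0_squared:
  "((\<lambda>x::real. (max 0 x)\<^sup>2) has_real_derivative 2 * max 0 x) (at x)"
proof (cases "x = 0")
  case True
  have "((\<lambda>h::real. (max 0 h)\<^sup>2 / h) \<longlongrightarrow> 0) (at 0)"
  proof (rule Lim_null_comparison)
    show "\<forall>\<^sub>F h in at (0::real). norm ((max 0 h)\<^sup>2 / h) \<le> \<bar>h\<bar>"
      by (rule always_eventually) (auto simp: max_def power2_eq_square)
    show "((\<lambda>h::real. \<bar>h\<bar>) \<longlongrightarrow> 0) (at 0)"
      by (rule tendsto_rabs_zero) (rule tendsto_ident_at)
  qed
  then show ?thesis using True by (simp add: DERIV_def)
next
  case False
  consider "x < 0" | "x > 0" using False by linarith
  then show ?thesis
  proof cases
    case 1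
    have "((\<lambda>x::real. 0) has_real_derivative 0) (at x)" by simp
    then have "((\<lambda>x::real. (max 0 x)\<^sup>2) has_real_derivative 0) (at x)"
      by (rule has_field_derivative_transform_within_open[where S = "{..<0}"])
        (use 1 in \<open>auto simp: max_def\<close>)
    then show ?thesis using 1 by (simp add: max_def)
  next
    case 2
    have "((\<lambda>x::real. x\<^sup>2) has_real_derivative 2 * x) (at x)"
      by (auto intro!: derivative_eq_intros)
    then have "((\<lambda>x::real. (max 0 x)\<^sup>2) has_real_derivative 2 * x) (at x)"
      by (rule has_field_derivative_transform_within_open[where S = "{0<..}"])
        (use 2 in \<open>auto simp: max_def\<close>)
    then show ?thesis using 2 by (simp add: max_def)
  qed
qed

lemma test_function_approx_indicator:
  fixes a b :: real
  assumes "0 < a" "b < 1"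
  obtains \<phi> \<phi>' where "\<And>n::nat. test_function (\<phi> n) (\<phi>' n)"
    "\<And>n x. \<bar>\<phi> n x\<bar> \<le> 1" "\<And>x. (\<lambda>n. \<phi> n x) \<longlonglongrightarrow> indicator {a<..<b} x"
proof -
  define m where "m = (\<lambda>x::real. max 0 x)"
  define \<psi> where "\<psi> = (\<lambda>x. (m (x - a))\<^sup>2 * (m (b - x))\<^sup>2)"
  define \<psi>' where "\<psi>' = (\<lambda>x. 2 * m (x - a) * (m (b - x))\<^sup>2 - (m (x - a))\<^sup>2 * (2 * m (b - x)))"
  define \<phi> where "\<phi> = (\<lambda>(n::nat) x. real n * \<psi> x / (1 + real n * \<psi> x))"
  define \<phi>' where "\<phi>' = (\<lambda>(n::nat) x. real n * \<psi>' x / (1 + real n * \<psi> x)\<^sup>2)"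
  have nonneg: "0 \<le> \<psi> x" for x by (simp add: \<psi>_def)
  have pos: "0 < 1 + real n * \<psi> x" for n x
    using mult_nonneg_nonneg[OF of_nat_0_le_iff nonneg] by (metis add_pos_nonneg zero_less_one)
  have d\<psi>: "(\<psi> has_real_derivative \<psi>' x) (at x)" for x
  proof -
    have 1: "((\<lambda>x. (m (x - a))\<^sup>2) has_real_derivative 2 * m (x - a) * 1) (at x)"
      unfolding m_def
      by (rule DERIV_chain2[OF has_real_derivative_max0_squared]) (auto intro!: derivative_eq_intros)
    have 2: "((\<lambda>x. (m (b - x))\<^sup>2) has_real_derivative 2 * m (b - x) * (- 1)) (at x)"
      unfolding m_def
      by (rule DERIV_chain2[OF has_real_derivative_max0_squared]) (auto intro!: derivative_eq_intros)
    show ?thesis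
      using DERIV_mult[OF 1 2] unfolding \<psi>_def \<psi>'_def by (simp add: algebra_simps)
  qed
  have c\<psi>: "continuous_on UNIV \<psi>" "continuous_on UNIV \<psi>'"
    unfolding \<psi>_def \<psi>'_def m_def by (intro continuous_intros)+
  show ?thesis
  proof (rule that[of \<phi> \<phi>'])
    fix n :: nat
    have "(\<phi> n has_real_derivative \<phi>' n x) (at x)" for x
    proof -
      have "(\<phi> n has_real_derivative
          (real n * \<psi>' x * (1 + real n * \<psi> x) - real n * \<psi> x * (real n * \<psi>' x))
            / ((1 + real n * \<psi> x) * (1 + real n * \<psi> x))) (at x)"
        unfolding \<phi>_def using pos[of n x]
        by (auto intro!: derivative_eq_intros d\<psi>)
      then show ?thesis
        unfolding \<phi>'_def by (simp add: algebra_simps power2_eq_square)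
    qed
    moreover have "continuous_on UNIV (\<phi>' n)"
      unfolding \<phi>'_def using pos[of n] by (intro continuous_intros c\<psi>) (metis less_irrefl power_not_zero)
    moreover have "closure {x. \<phi> n x \<noteq> 0} \<subseteq> {a..b}"
      by (rule closure_minimal) (auto simp: \<phi>_def \<psi>_def m_def max_def split: if_splits)
    then have "closure {x. \<phi> n x \<noteq> 0} \<subseteq> {0<..<1}"
      using assms by fastforce
    ultimately show "test_function (\<phi> n) (\<phi>' n)"
      by (simp add: test_function_def)
  next
    fix n x
    show "\<bar>\<phi> n x\<bar> \<le> 1"
      using pos[of n x] nonneg[of x] by (simp add: \<phi>_def)
  next
    fix x
    show "(\<lambda>n. \<phi> n x) \<longlonglongrightarrow> indicator {a<..<b} x"
    proof (cases "x \<in> {a<..<b}")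
      case True
      then have p: "0 < \<psi> x" by (simp add: \<psi>_def m_def)
      have "(\<lambda>n. 1 - inverse (1 + real n * \<psi> x)) \<longlonglongrightarrow> 1 - 0"
        by (intro tendsto_intros tendsto_inverse_0_at_top filterlim_tendsto_add_at_top[OF tendsto_const]
            filterlim_at_top_mult_tendsto_pos[OF tendsto_const p] filterlim_real_sequentially)
      moreover have "1 - inverse (1 + real n * \<psi> x) = \<phi> n x" for n
        using pos[of n x] by (simp add: \<phi>_def field_simps)
      ultimately show ?thesis using True by simp
    next
      case False
      then have "\<psi> x = 0" by (auto simp: \<psi>_def m_def)
      then show ?thesis using False by (simp add: \<phi>_def)
    qed
  qed
qed

lemma AE_zero_of_test_functions:
  fixes f :: "real \<Rightarrow> real"
  assumes f: "integrable lebesgue01 f"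
    and z: "\<And>\<phi> \<phi>'. test_function \<phi> \<phi>' \<Longrightarrow> (LINT x|lebesgue01. f x * \<phi> x) = 0"
  shows "AE x in lebesgue01. f x = 0"
proof -
  define F where "F = (\<lambda>x. indicator {0<..<1} x * f x)"
  have F: "integrable lebesgue F"
    using f by (simp add: F_def integrable_restrict_space)
  have FI: "F integrable_on {a..b}" for a b :: real
    using integrable_on_subinterval[OF integrable_on_lebesgue[OF F], of a b] by simp
  have zero: "integral {a..b} F = 0" if ab: "0 < a" "b < 1" for a b :: real
  proof -
    obtain \<phi> \<phi>' where \<phi>: "\<And>n::nat. test_function (\<phi> n) (\<phi>' n)"
      "\<And>n x. \<bar>\<phi> n x\<bar> \<le> 1" "\<And>x. (\<lambda>n. \<phi> n x) \<longlonglongrightarrow> indicator {a<..<b} x"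
      by (rule test_function_approx_indicator[OF ab]) blast
    have "(\<lambda>n. LINT x|lebesgue01. f x * \<phi> n x) \<longlonglongrightarrow> (LINT x|lebesgue01. f x * indicator {a<..<b} x)"
    proof (rule integral_dominated_convergence)
      show "(\<lambda>x. f x * indicator {a<..<b} x) \<in> borel_measurable lebesgue01"
        using f by (intro borel_measurable_times borel_measurable_indicator)
          (use ab in \<open>auto simp: sets_restrict_space_iff\<close>)
      show "(\<lambda>x. f x * \<phi> n x) \<in> borel_measurable lebesgue01" for n
        using integrable_mult_continuous[OF f test_function_continuous(1)[OF \<phi>(1)]]
        by (rule borel_measurable_integrable)
      show "integrable lebesgue01 (\<lambda>x. \<bar>f x\<bar>)" using f by simp
      show "AE x in lebesgue01. (\<lambda>n. f x * \<phi> n x) \<longlonglongrightarrow> f x * indicator {a<..<b} x"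
        by (intro AE_I2 tendsto_mult tendsto_const \<phi>)
      show "AE x in lebesgue01. norm (f x * \<phi> n x) \<le> \<bar>f x\<bar>" for n
        using \<phi>(2)[of n] by (intro AE_I2) (simp add: abs_mult mult_left_le)
    qed
    then have "(LINT x|lebesgue01. f x * indicator {a<..<b} x) = 0"
      by (simp add: z[OF \<phi>(1)] LIMSEQ_const_iff)
    also have "(LINT x|lebesgue01. f x * indicator {a<..<b} x)
        = (LINT x|lebesgue. indicator {a<..<b} x * F x)"
      by (subst integral_restrict_space)
        (auto simp: F_def intro!: Bochner_Integration.integral_cong split: split_indicator)
    also have "\<dots> = integral {a<..<b} F"
    proof -
      have "set_integrable lebesgue {a<..<b} F"
        unfolding set_integrable_def
        using integrable_mult_indicator[OF _ F, of "{a<..<b}"] by simp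
      then show ?thesis
        using set_lebesgue_integral_eq_integral(2)[of "{a<..<b}" F]
        by (simp add: set_lebesgue_integral_def)
    qed
    also have "\<dots> = integral {a..b} F"
      by (simp add: integral_open_interval_real)
    finally show ?thesis .
  qed
  obtain N where N: "negligible N"
    "\<And>x e. \<lbrakk>x \<notin> N; 0 < e\<rbrakk> \<Longrightarrow> \<exists>d>0. \<forall>h. 0 < h \<and> h < d \<longrightarrow>
      norm (integral (cbox x (x + h *\<^sub>R One)) F /\<^sub>R h ^ DIM(real) - F x) < e"
    using integrable_ccontinuous_explicit[of F] FI by (metis interval_cbox)
  have "F x = 0" if x: "x \<in> {0<..<1}" "x \<notin> N" for x
  proof (rule ccontr)
    assume "F x \<noteq> 0"
    then obtain d where d: "d > 0" "\<And>h. 0 < h \<and> h < d \<Longrightarrow>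
      norm (integral (cbox x (x + h *\<^sub>R One)) F /\<^sub>R h ^ DIM(real) - F x) < \<bar>F x\<bar>"
      using N(2)[OF x(2), of "\<bar>F x\<bar>"] by auto
    define h where "h = min (d / 2) ((1 - x) / 2)"
    have h: "0 < h" "h < d" "x + h < 1"
      using d(1) x(1) by (auto simp: h_def min_def field_simps)
    show False
      using d(2)[of h] h zero[of x "x + h"] x(1) by simp
  qed
  then have "AE x in lebesgue. x \<in> {0<..<1} \<longrightarrow> f x = 0"
    using N(1) by (intro AE_I'[of N]) (auto simp: negligible_iff_null_sets F_def)
  then show ?thesis
    by (simp add: AE_restrict_space_iff)
qed

lemma weak_deriv_unique:
  assumes "weak_deriv u g" "weak_deriv u k"
  shows "g = k"
proof -
  have w: "weak_deriv 0 (g - k)"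
    using weak_deriv_minus[OF assms] by simp
  have "AE x in lebesgue01. rep_L1 (g - k) x = 0"
  proof (rule AE_zero_of_test_functions[OF integrable_rep_L1])
    fix \<phi> \<phi>' assume t: "test_function \<phi> \<phi>'"
    have "(LINT x|lebesgue01. rep_L1 0 x * \<phi>' x) = 0"
      by (rule integral_eq_zero_AE) (use rep_L1_zero in \<open>auto elim: eventually_mono\<close>)
    with w t show "(LINT x|lebesgue01. rep_L1 (g - k) x * \<phi> x) = 0"
      unfolding weak_deriv_def by fastforce
  qed
  then have "g - k = 0"
    using rep_L1_zero by (intro L1_eqI) (auto elim: eventually_elim2)
  then show ?thesis by simp
qed

definition L1_weak_deriv :: "L1 \<Rightarrow> L1" where
  "L1_weak_deriv u = (THE g. weak_deriv u g)"

lemma L1_weak_deriv_eq: "weak_deriv u g \<Longrightarrow> L1_weak_deriv u = g"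
  unfolding L1_weak_deriv_def using weak_deriv_unique by blast

typedef W11 = "{u. \<exists>g. weak_deriv u g}"
  using weak_deriv_zero by blast

setup_lifting type_definition_W11

lift_definition W11_deriv :: "W11 \<Rightarrow> L1" is L1_weak_deriv .

lemma W11_deriv: "weak_deriv (Rep_W11 u) (W11_deriv u)"
  using Rep_W11[of u] by (auto simp: W11_deriv.rep_eq L1_weak_deriv_eq)

instantiation W11 :: real_vector
begin

lift_definition zero_W11 :: W11 is 0 using weak_deriv_zero by blast
lift_definition plus_W11 :: "W11 \<Rightarrow> W11 \<Rightarrow> W11" is "(+)" using weak_deriv_add by blast
lift_definition minus_W11 :: "W11 \<Rightarrow> W11 \<Rightarrow> W11" is "(-)" using weak_deriv_minus by blast
lift_definition uminus_W11 :: "W11 \<Rightarrow> W11" is uminus using weak_deriv_uminus by blast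
lift_definition scaleR_W11 :: "real \<Rightarrow> W11 \<Rightarrow> W11" is scaleR using weak_deriv_scaleR by blast

instance
proof
  fix u v w :: W11 and a b :: real
  show "u + v + w = u + (v + w)" by transfer (simp add: algebra_simps)
  show "u + v = v + u" by transfer (simp add: algebra_simps)
  show "0 + u = u" by transfer simp
  show "- u + u = 0" by transfer simp
  show "u - v = u + - v" by transfer simp
  show "a *\<^sub>R (u + v) = a *\<^sub>R u + a *\<^sub>R v" by transfer (simp add: algebra_simps)
  show "(a + b) *\<^sub>R u = a *\<^sub>R u + b *\<^sub>R u" by transfer (simp add: algebra_simps)
  show "a *\<^sub>R b *\<^sub>R u = (a * b) *\<^sub>R u" by transfer simp
  show "1 *\<^sub>R u = u" by transfer simp
qed

end

lemma W11_deriv_add: "W11_deriv (u + v) = W11_deriv u + W11_deriv v"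
  unfolding W11_deriv.rep_eq plus_W11.rep_eq
  using W11_deriv[of u] W11_deriv[of v] by (metis L1_weak_deriv_eq weak_deriv_add)

lemma W11_deriv_scaleR: "W11_deriv (c *\<^sub>R u) = c *\<^sub>R W11_deriv u"
  unfolding W11_deriv.rep_eq scaleR_W11.rep_eq
  using W11_deriv[of u] by (metis L1_weak_deriv_eq weak_deriv_scaleR)

lemma W11_deriv_zero: "W11_deriv 0 = 0"
  by (simp add: W11_deriv.rep_eq zero_W11.rep_eq L1_weak_deriv_eq weak_deriv_zero)

instantiation W11 :: real_normed_vector
begin

definition norm_W11 :: "W11 \<Rightarrow> real" where
  "norm_W11 u = norm (Rep_W11 u) + norm (W11_deriv u)"

definition dist_W11 :: "W11 \<Rightarrow> W11 \<Rightarrow> real" where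
  "dist_W11 u v = norm (u - v)"

definition sgn_W11 :: "W11 \<Rightarrow> W11" where
  "sgn_W11 u = u /\<^sub>R norm u"

definition uniformity_W11 :: "(W11 \<times> W11) filter" where
  "uniformity_W11 = (INF e\<in>{0<..}. principal {(x, y). dist x y < e})"

definition open_W11 :: "W11 set \<Rightarrow> bool" where
  "open_W11 U = (\<forall>x\<in>U. eventually (\<lambda>(x', y). x' = x \<longrightarrow> y \<in> U) uniformity)"

instance
proof
  fix u v w :: W11 and a b :: real
  show "norm u = 0 \<longleftrightarrow> u = 0"
    using W11_deriv_zero
    by (metis Rep_W11_inject add.right_neutral add_nonneg_eq_0_iff norm_W11_def norm_ge_zero
        norm_zero norm_eq_zero zero_W11.rep_eq)
  show "norm (u + v) \<le> norm u + norm v"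
    unfolding norm_W11_def W11_deriv_add plus_W11.rep_eq
    using norm_triangle_ineq[of "Rep_W11 u" "Rep_W11 v"]
      norm_triangle_ineq[of "W11_deriv u" "W11_deriv v"] by linarith
  show "norm (a *\<^sub>R u) = \<bar>a\<bar> * norm u"
    by (simp add: norm_W11_def W11_deriv_scaleR scaleR_W11.rep_eq distrib_left)
qed (simp_all add: dist_W11_def sgn_W11_def uniformity_W11_def open_W11_def)

end

definition represents_W11 :: "(real \<Rightarrow> real) \<Rightarrow> W11 \<Rightarrow> bool" where
  "represents_W11 f u \<longleftrightarrow> represents_L1 f (Rep_W11 u)"

definition phi :: "real \<Rightarrow> real \<Rightarrow> real" where
  "phi q \<xi> = \<bar>\<xi>\<bar> powr (q - 2) * \<xi>"

definition p_star :: "real \<Rightarrow> real" where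
  "p_star p = 1 / (p - 1)"

definition p_conj :: "real \<Rightarrow> real" where
  "p_conj p = p / (p - 1)"

text \<open>At \<open>s = 0\<close> the domain of integration is a single point, so the value is 0.\<close>

definition J :: "nat \<Rightarrow> (real \<Rightarrow> real) \<Rightarrow> real \<Rightarrow> real" where
  "J N h s = integral {0..s} (\<lambda>t. (t / s) ^ (N - 1) * h t)"

definition I_op :: "(real \<Rightarrow> real) \<Rightarrow> real \<Rightarrow> real" where
  "I_op k r = integral {r..1} k"

definition S_op :: "nat \<Rightarrow> real \<Rightarrow> C0 \<Rightarrow> real \<Rightarrow> real" where
  "S_op N p h r = integral {r..1} (\<lambda>s. phi (p_conj p)
     (integral {0..s} (\<lambda>t. (t / s) ^ (N - 1) * C0_fun h t)))"

text \<open>Derivative on the closed interval, one-sided at the end points.\<close>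

definition D01 :: "(real \<Rightarrow> real) \<Rightarrow> real \<Rightarrow> real" where
  "D01 f r = vector_derivative f (at r within {0..1})"

definition DS_formula :: "nat \<Rightarrow> real \<Rightarrow> C0 \<Rightarrow> C0 \<Rightarrow> real \<Rightarrow> real" where
  "DS_formula N p h hb r =
     p_star p * I_op (\<lambda>s. \<bar>D01 (S_op N p h) s\<bar> powr (2 - p) * J N (C0_fun hb) s) r"

text \<open>The class \<open>G\<close> is that of $|u'|^{2-p}$ for \<open>p > 2\<close>. This function is infinite at the zeros of
  \<open>u'\<close>, where \<open>powr\<close> returns 0; hence the explicit requirement that they form a null set.\<close>

definition represents_weight :: "real \<Rightarrow> (real \<Rightarrow> real) \<Rightarrow> L1 \<Rightarrow> bool" where
  "represents_weight p u G \<longleftrightarrow>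
     (AE r in lebesgue01. D01 u r \<noteq> 0) \<and> represents_L1 (\<lambda>r. \<bar>D01 u r\<bar> powr (2 - p)) G"

text \<open>The function \<open>v\<close> solves
  $-(r^{N-1}|u'|^{p-2}v')' = p^* r^{N-1}\bar h$ in $(0,1)$, $v'(0)=v(1)=0$.
  At a zero of \<open>u'\<close> the product $|u'|^{p-2}v'$ has no literal value: for \<open>p < 2\<close> the
  coefficient is infinite there, for \<open>p > 2\<close> the coefficient vanishes but \<open>v\<close> need not be
  differentiable. So the flux $r^{N-1}|u'|^{p-2}v'$ is a function \<open>w\<close>, differentiable on the
  whole of $(0,1)$, which has this value wherever \<open>u' \<noteq> 0\<close>; for \<open>p < 2\<close>, finiteness
  of the flux moreover forces \<open>v' = 0\<close> wherever \<open>u' = 0\<close>.\<close>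

definition linearised_bvp ::
  "nat \<Rightarrow> real \<Rightarrow> (real \<Rightarrow> real) \<Rightarrow> (real \<Rightarrow> real) \<Rightarrow> (real \<Rightarrow> real) \<Rightarrow> bool" where
  "linearised_bvp N p u hb v \<longleftrightarrow>
     (\<exists>w. (\<forall>r\<in>{0<..<1}. D01 u r \<noteq> 0 \<longrightarrow>
              v differentiable (at r) \<and> w r = r ^ (N - 1) * \<bar>D01 u r\<bar> powr (p - 2) * deriv v r) \<and>
          (\<forall>r\<in>{0<..<1}. D01 u r = 0 \<and> p < 2 \<longrightarrow> (v has_real_derivative 0) (at r)) \<and>
          (\<forall>r\<in>{0<..<1}. (w has_real_derivative - (p_star p * r ^ (N - 1) * hb r)) (at r))) \<and>
     (v has_real_derivative 0) (at 0 within {0..1}) \<and> v 1 = 0"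

text \<open>For open \<open>V\<close>; the values of \<open>F\<close> and \<open>D\<close> outside \<open>V\<close> play no role.\<close>

definition C1_map_on ::
  "'a set \<Rightarrow> ('a::real_normed_vector \<Rightarrow> 'b::real_normed_vector) \<Rightarrow> ('a \<Rightarrow> 'a \<Rightarrow>\<^sub>L 'b) \<Rightarrow> bool" where
  "C1_map_on V F D \<longleftrightarrow>
     (\<forall>h\<in>V. (F has_derivative blinfun_apply (D h)) (at h)) \<and> continuous_on V D"

end

theory Submission
  imports Defs
begin

text \<open>
  Write $q = p'$, so that $u(h)' = -\phi_q(J(h))$ and $|u(h)'|^{2-p} = |J(h)|^{q-2}$. For \<open>p < 2\<close> the
  function $\phi_q$ is $C^1$ and the claim is the differentiability of a Nemytskii operator on $C^0$.

  For \<open>p > 2\<close> the exponent $q - 2$ lies in $(-1, 0)$. By hypothesis $J(h_0)$ and $h_0$ have no common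
  zero. As $(s^{N-1} J(h))' = s^{N-1} h$, on each interval of a fine partition either $|J(h)|$ is
  bounded below or $J(h)$ grows at least linearly away from some point \<open>z\<close>, uniformly for \<open>h\<close> near
  $h_0$. Hence $\int_0^1 |J(h)|^b$ is bounded near $h_0$ for every $b > -1$. The elementary estimates
  \[ \bigl||x|^a - |y|^a\bigr| \le |x - y|^\theta \bigl(|x|^{a-\theta} + |y|^{a-\theta}\bigr) \]
  and
  \[ |\phi_q(y) - \phi_q(x) - (q - 1)|x|^{q-2}(y - x)|
      \le 3|y - x|^{1+\theta}\bigl(|x|^{q-2-\theta} + |y|^{q-2-\theta}\bigr) \]
  with \<open>\<theta>\<close> so small that the exponents stay above \<open>- 1\<close> then give Hoelder continuity of the weight
  in $L^1$ and the Taylor remainder of $S_p$ in $W^{1,1}$.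
\<close>


subsection \<open>Pointwise estimates for powers\<close>

text \<open>The obstacle for p > 2 is that the zeros of \<open>J h\<close> move with h, so the
  weights of two neighbouring functions are unbounded at different points and no pointwise Taylor
  estimate is uniform. This is why the right-hand sides of both inequalities are sums of one term in
  x and one in y: after integration each function is estimated alone, and zero sets are never
  compared. The room for \<theta> exists because b > -1 is an open condition.

  The point 0 is a zero of \<open>J h\<close> for every h, and there the factor s^(N-1) may
  degenerate as well. The hypothesis therefore contains h0(0) \<noteq> 0, and the resulting linear
  growth of \<open>J h\<close> at 0 is also what yields v'(0) = 0.

  For p < 2 the zeros are harmless: q - 2 is positive, and uniform continuity of |x|^(q-2) on
  bounded sets suffices. In both cases the solution and its derivative are primitives vanishing at
  1, and the norm of such a primitive is at most twice the sup norm or the L1 norm of the integrand.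
  All analysis thus takes place on integrands.\<close>

lemma powr_diff_le_Holder:
  fixes x y :: real
  assumes a: "- 1 \<le> a" "a \<le> 0" and t: "0 < \<theta>" "\<theta> \<le> 1" and xy: "0 < x" "x < y"
  shows "x powr a - y powr a \<le> (y - x) powr \<theta> * x powr (a - \<theta>)"
proof (cases "x \<le> y - x")
  \<comment> \<open>The gap \<open>y - x\<close> dominates \<open>x\<close>, so the factor
    \<open>x powr \<theta>\<close> split off from \<open>x powr a\<close> may be enlarged to a power
    of the gap; the term in y is dropped.\<close>
  case True
  have "x powr a = x powr \<theta> * x powr (a - \<theta>)"
    using xy by (simp flip: powr_add)
  also have "\<dots> \<le> (y - x) powr \<theta> * x powr (a - \<theta>)"
    using True xy t by (intro mult_right_mono powr_mono2) auto
  finally show ?thesis by (smt (verit) powr_ge_zero)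
next
  \<comment> \<open>Now \<open>y - x < x\<close>. The mean value theorem supplies a full factor
    \<open>y - x\<close>; its surplus power 1 - \<theta> is traded for the same power of x.\<close>
  case False
  have "\<exists>z. x < z \<and> z < y \<and> y powr a - x powr a = (y - x) * (a * z powr (a - 1))"
    using xy by (intro MVT2) (auto intro!: derivative_eq_intros)
  then obtain z where z: "x < z" "z < y" "y powr a - x powr a = (y - x) * (a * z powr (a - 1))"
    by blast
  have "x powr a - y powr a = (y - x) * ((- a) * z powr (a - 1))"
    using z(3) by (simp add: algebra_simps)
  also have "\<dots> \<le> (y - x) * (1 * x powr (a - 1))"
    using xy z a by (intro mult_left_mono mult_mono powr_mono2') auto
  also have "\<dots> = (y - x) powr \<theta> * ((y - x) powr (1 - \<theta>) * x powr (a - 1))"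
    using xy by (simp flip: powr_add mult.assoc)
  also have "\<dots> \<le> (y - x) powr \<theta> * (x powr (1 - \<theta>) * x powr (a - 1))"
    using xy t False by (intro mult_left_mono mult_right_mono powr_mono2) auto
  also have "x powr (1 - \<theta>) * x powr (a - 1) = x powr (a - \<theta>)"
    by (simp flip: powr_add)
  finally show ?thesis .
qed

text \<open>Holds without restriction on \<open>x\<close> and \<open>y\<close> because \<open>0 powr e = 0\<close>.\<close>

lemma abs_powr_diff_le_Holder:
  fixes x y :: real
  assumes a: "- 1 \<le> a" "a \<le> 0" and t: "0 < \<theta>" "\<theta> \<le> 1"
  shows "\<bar>\<bar>x\<bar> powr a - \<bar>y\<bar> powr a\<bar> \<le> \<bar>x - y\<bar> powr \<theta> * (\<bar>x\<bar> powr (a - \<theta>) + \<bar>y\<bar> powr (a - \<theta>))"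
proof -
  have *: "\<bar>u powr a - v powr a\<bar> \<le> (v - u) powr \<theta> * (u powr (a - \<theta>) + v powr (a - \<theta>))"
    if uv: "0 \<le> u" "u \<le> v" for u v :: real
  proof -
    consider "u = v" | "u = 0" "0 < v" | "0 < u" "u < v" using uv by linarith
    then show ?thesis
    proof cases
      case 3
      have "v powr a \<le> u powr a" using 3 a by (intro powr_mono2') auto
      moreover have "(v - u) powr \<theta> * u powr (a - \<theta>) 
          \<le> (v - u) powr \<theta> * (u powr (a - \<theta>) + v powr (a - \<theta>))"
        by (intro mult_left_mono) auto
      ultimately show ?thesis using powr_diff_le_Holder[OF a t 3] by linarith
    qed (auto simp flip: powr_add)
  qed
  have **: "\<bar>u powr a - v powr a\<bar> \<le> \<bar>u - v\<bar> powr \<theta> * (u powr (a - \<theta>) + v powr (a - \<theta>))"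
    if "0 \<le> u" "0 \<le> v" for u v :: real
    using *[of u v] *[of v u] that
    by (cases "u \<le> v") (simp_all add: abs_minus_commute add.commute)
  have "\<bar>\<bar>x\<bar> - \<bar>y\<bar>\<bar> powr \<theta> \<le> \<bar>x - y\<bar> powr \<theta>" using t by (intro powr_mono2) auto
  then have "\<bar>\<bar>x\<bar> - \<bar>y\<bar>\<bar> powr \<theta> * (\<bar>x\<bar> powr (a - \<theta>) + \<bar>y\<bar> powr (a - \<theta>))
    \<le> \<bar>x - y\<bar> powr \<theta> * (\<bar>x\<bar> powr (a - \<theta>) + \<bar>y\<bar> powr (a - \<theta>))"
    by (intro mult_right_mono) auto
  then show ?thesis using **[of "\<bar>x\<bar>" "\<bar>y\<bar>"] by simp
qed

lemma abs_phi: "\<bar>phi q x\<bar> = \<bar>x\<bar> powr (q - 1)"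
proof (cases "x = 0")
  case False
  then have "\<bar>x\<bar> powr (q - 2) * \<bar>x\<bar> powr 1 = \<bar>x\<bar> powr (q - 1)"
    unfolding powr_add[symmetric] by simp
  with False show ?thesis by (simp add: phi_def abs_mult)
qed (simp add: phi_def)

lemma DERIV_phi_nonzero:
  assumes "x \<noteq> 0"
  shows "(phi q has_real_derivative (q - 1) * \<bar>x\<bar> powr (q - 2)) (at x)"
proof -
  have pos: "(phi q has_real_derivative (q - 1) * y powr (q - 2)) (at y)" if "0 < y" for y
  proof -
    have "((\<lambda>y. y powr (q - 1)) has_real_derivative (q - 1) * y powr (q - 2)) (at y)"
      using that by (auto intro!: derivative_eq_intros)
    then show ?thesis
    proof (rule has_field_derivative_transform_within_open[where S = "{0<..}"])
      fix z :: real assume "z \<in> {0<..}"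
      then have "0 < z" by simp
      then have "z powr (q - 2) * z powr 1 = z powr (q - 1)"
        unfolding powr_add[symmetric] by simp
      then show "z powr (q - 1) = phi q z" using \<open>0 < z\<close> by (simp add: phi_def)
    qed (use that in auto)
  qed
  show ?thesis
  proof (cases "0 < x")
    case True then show ?thesis using pos[of x] by simp
  next
    case False
    then have "((\<lambda>y. - phi q (- y)) has_real_derivative - ((q - 1) * (- x) powr (q - 2) * (- 1))) (at x)"
      using assms by (intro DERIV_minus DERIV_chain2[OF pos]) (auto intro!: derivative_eq_intros)
    moreover have "(\<lambda>y. - phi q (- y)) = phi q" by (simp add: phi_def fun_eq_iff)
    ultimately show ?thesis using False by simp
  qed
qed

text \<open>If x and y have the same sign, the segment between them avoids 0 and the mean value
  theorem reduces the claim to the Hoelder estimate for |.|^(q-2). Otherwise |x| and |y| are both at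
  most |y - x|, there is no cancellation to exploit, and the three terms on the left are bounded one
  by one.\<close>

lemma phi_remainder_le:
  assumes q: "1 < q" "q < 2" and t: "0 < \<theta>" "\<theta> \<le> 1"
  shows "\<bar>phi q y - phi q x - (q - 1) * \<bar>x\<bar> powr (q - 2) * (y - x)\<bar>
    \<le> 3 * \<bar>y - x\<bar> powr (1 + \<theta>) * (\<bar>x\<bar> powr (q - 2 - \<theta>) + \<bar>y\<bar> powr (q - 2 - \<theta>))"
    (is "?L \<le> 3 * ?K * (?X + ?Y)")
proof (cases "0 < x * y")
  case True
  have nz: "z \<noteq> 0" if "min x y \<le> z" "z \<le> max x y" for z
    using True that by (auto simp: min_def max_def zero_less_mult_iff split: if_splits)
  have "\<exists>z. min x y \<le> z \<and> z \<le> max x y \<and>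
    phi q y - phi q x = (y - x) * ((q - 1) * \<bar>z\<bar> powr (q - 2))"
  proof (rule linorder_cases[of x y])
    assume "x < y"
    then show ?thesis
      using MVT2[of x y "phi q" "\<lambda>z. (q - 1) * \<bar>z\<bar> powr (q - 2)"] nz DERIV_phi_nonzero
      by (smt (verit))
  next
    assume "y < x"
    then obtain z where "y < z" "z < x" "phi q x - phi q y = (x - y) * ((q - 1) * \<bar>z\<bar> powr (q - 2))"
      using MVT2[of y x "phi q" "\<lambda>z. (q - 1) * \<bar>z\<bar> powr (q - 2)"] nz DERIV_phi_nonzero
      by (smt (verit))
    then show ?thesis by (intro exI[of _ z]) (auto simp: algebra_simps)
  qed auto
  then obtain z where z: "min x y \<le> z" "z \<le> max x y"
    "phi q y - phi q x = (y - x) * ((q - 1) * \<bar>z\<bar> powr (q - 2))" by blast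
  \<comment> \<open>The intermediate point is no closer to 0 than the nearer of x and y, and the
    exponent is negative.\<close>
  have Z: "\<bar>z\<bar> powr (q - 2 - \<theta>) \<le> ?X + ?Y"
  proof -
    have "min \<bar>x\<bar> \<bar>y\<bar> \<le> \<bar>z\<bar>" "0 < min \<bar>x\<bar> \<bar>y\<bar>"
      using z(1,2) True by (auto simp: min_def max_def zero_less_mult_iff split: if_splits)
    then have "\<bar>z\<bar> powr (q - 2 - \<theta>) \<le> (min \<bar>x\<bar> \<bar>y\<bar>) powr (q - 2 - \<theta>)"
      using q t by (intro powr_mono2') auto
    also have "\<dots> \<le> ?X + ?Y" by (simp add: min_def)
    finally show ?thesis .
  qed
  have "?L = \<bar>y - x\<bar> * ((q - 1) * \<bar>\<bar>z\<bar> powr (q - 2) - \<bar>x\<bar> powr (q - 2)\<bar>)"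
  proof -
    have "phi q y - phi q x - (q - 1) * \<bar>x\<bar> powr (q - 2) * (y - x)
       = (y - x) * ((q - 1) * (\<bar>z\<bar> powr (q - 2) - \<bar>x\<bar> powr (q - 2)))"
      unfolding z(3) by (simp add: algebra_simps)
    then show ?thesis using q by (simp add: abs_mult)
  qed
  also have "\<dots> \<le> \<bar>y - x\<bar> * (1 * (\<bar>z - x\<bar> powr \<theta> * (\<bar>z\<bar> powr (q - 2 - \<theta>) + ?X)))"
    using q t by (intro mult_left_mono mult_mono abs_powr_diff_le_Holder) auto
  also have "\<dots> \<le> \<bar>y - x\<bar> * (1 * (\<bar>y - x\<bar> powr \<theta> * ((?X + ?Y) + (?X + ?Y))))"
    using z(1,2) Z t by (intro mult_left_mono mult_mono add_mono powr_mono2) (auto simp: min_def max_def split: if_splits)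
  also have "\<dots> = 2 * (\<bar>y - x\<bar> powr 1 * \<bar>y - x\<bar> powr \<theta>) * (?X + ?Y)" by simp
  also have "\<bar>y - x\<bar> powr 1 * \<bar>y - x\<bar> powr \<theta> = ?K" by (simp only: powr_add)
  also have "2 * ?K * (?X + ?Y) \<le> 3 * ?K * (?X + ?Y)"
    by (intro mult_right_mono) auto
  finally show ?thesis .
next
  case False
  then have le: "\<bar>x\<bar> \<le> \<bar>y - x\<bar>" "\<bar>y\<bar> \<le> \<bar>y - x\<bar>"
    by (auto simp: zero_less_mult_iff)
  have b: "\<bar>phi q w\<bar> \<le> ?K * \<bar>w\<bar> powr (q - 2 - \<theta>)" if "\<bar>w\<bar> \<le> \<bar>y - x\<bar>" for w
  proof -
    have "\<bar>phi q w\<bar> = \<bar>w\<bar> powr (1 + \<theta>) * \<bar>w\<bar> powr (q - 2 - \<theta>)"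
      unfolding abs_phi powr_add[symmetric] by simp
    also have "\<dots> \<le> ?K * \<bar>w\<bar> powr (q - 2 - \<theta>)"
      using that t by (intro mult_right_mono powr_mono2) auto
    finally show ?thesis .
  qed
  have "\<bar>(q - 1) * \<bar>x\<bar> powr (q - 2) * (y - x)\<bar> \<le> ?K * ?X"
  proof -
    have "\<bar>(q - 1) * \<bar>x\<bar> powr (q - 2) * (y - x)\<bar> = (q - 1) * (\<bar>x\<bar> powr \<theta> * ?X * \<bar>y - x\<bar> powr 1)"
      unfolding powr_add[symmetric] using q by (simp add: abs_mult)
    also have "\<dots> \<le> 1 * (\<bar>y - x\<bar> powr \<theta> * ?X * \<bar>y - x\<bar> powr 1)"
      using le q t by (intro mult_mono order_refl powr_mono2) auto
    also have "\<dots> = (\<bar>y - x\<bar> powr 1 * \<bar>y - x\<bar> powr \<theta>) * ?X" by simp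
    also have "\<bar>y - x\<bar> powr 1 * \<bar>y - x\<bar> powr \<theta> = ?K" by (simp only: powr_add)
    finally show ?thesis .
  qed
  then have "?L \<le> ?K * ?Y + ?K * ?X + ?K * ?X"
    using b[OF le(1)] b[OF le(2)] by linarith
  also have "\<dots> \<le> 3 * ?K * (?X + ?Y)"
  proof -
    have "0 \<le> ?K * ?X" "0 \<le> ?K * ?Y" by auto
    moreover have "3 * ?K * (?X + ?Y) = 3 * (?K * ?X) + 3 * (?K * ?Y)" by (simp add: algebra_simps)
    ultimately show ?thesis by linarith
  qed
  finally show ?thesis .
qed

lemma DERIV_phi:
  assumes "2 < q"
  shows "(phi q has_real_derivative (q - 1) * \<bar>x\<bar> powr (q - 2)) (at x)"
proof (cases "x = 0")
  case True
  have "((\<lambda>h. \<bar>h\<bar> powr (q - 2)) \<longlongrightarrow> \<bar>0::real\<bar> powr (q - 2)) (at 0)"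
    using assms by (intro tendsto_powr' tendsto_intros) auto
  moreover have "\<forall>\<^sub>F h in at 0. \<bar>h\<bar> powr (q - 2) = (phi q (0 + h) - phi q 0) / h"
    by (auto simp: eventually_at_filter phi_def)
  ultimately have "((\<lambda>h. (phi q (0 + h) - phi q 0) / h) \<longlongrightarrow> \<bar>0\<bar> powr (q - 2)) (at 0)"
    by (rule Lim_transform_eventually)
  then show ?thesis using True assms by (simp add: DERIV_def)
qed (rule DERIV_phi_nonzero)

lemma continuous_on_abs_powr:
  fixes a :: real assumes "0 < a" shows "continuous_on S (\<lambda>x::real. \<bar>x\<bar> powr a)"
  using assms by (intro continuous_on_powr' continuous_intros) auto

lemma continuous_on_phi:
  assumes "1 < q" shows "continuous_on S (phi q)"
proof -
  have "isCont (phi q) x" for x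
  proof (cases "x = 0")
    case True
    have "((\<lambda>h. \<bar>h\<bar> powr (q - 1)) \<longlongrightarrow> \<bar>0::real\<bar> powr (q - 1)) (at 0)"
      using assms by (intro tendsto_powr' tendsto_intros) auto
    then have "((\<lambda>h. \<bar>phi q h\<bar>) \<longlongrightarrow> 0) (at 0)" using assms by (simp add: abs_phi)
    then have "(phi q \<longlongrightarrow> 0) (at 0)" by (rule tendsto_rabs_zero_cancel)
    then show ?thesis using True by (simp add: isCont_def phi_def)
  qed (blast intro: DERIV_isCont DERIV_phi_nonzero)
  then show ?thesis by (simp add: continuous_at_imp_continuous_on)
qed

subsection \<open>The averaging operator and the linearised equation\<close>

lemma at_within_unit_interval: "0 < r \<Longrightarrow> r < 1 \<Longrightarrow> at (r::real) within {0..1} = at r"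
  by (rule at_within_Icc_at)

text \<open>Continuity is asked for at the single point r only, because for p > 2 the integrands are
  discontinuous at the zeros of \<open>J h\<close>.\<close>

lemma has_real_derivative_I_op:
  assumes "f integrable_on {0..1}" "r \<in> {0..1}" "continuous (at r within {0..1}) f"
  shows "(I_op f has_real_derivative - f r) (at r within {0..1})"
proof -
  have "((\<lambda>u. integral {0..u} f) has_vector_derivative f r) (at r within ({0..1} - {}))"
    using assms by (intro integral_has_vector_derivative_continuous_at) auto
  then have "((\<lambda>u. integral {0..u} f) has_real_derivative f r) (at r within {0..1})"
    by (simp add: has_real_derivative_iff_has_vector_derivative)
  then have "((\<lambda>u. integral {0..1} f - integral {0..u} f) has_real_derivative 0 - f r) (at r within {0..1})"
    by (intro DERIV_diff DERIV_const)
  then have "((\<lambda>u. integral {0..1} f - integral {0..u} f) has_real_derivative - f r) (at r within {0..1})"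
    by simp
  then show ?thesis
  proof (rule has_field_derivative_transform_within[where d = 1])
    fix u :: real assume "u \<in> {0..1}"
    then show "integral {0..1} f - integral {0..u} f = I_op f u"
      using Henstock_Kurzweil_Integration.integral_combine[where a=0 and c=u and b=1 and f=f] assms(1) by (simp add: I_op_def)
  qed (use assms in auto)
qed

lemma J_0 [simp]: "J N f 0 = 0"
  by (simp add: J_def)

text \<open>Clearing the denominator removes s from the integrand, which leaves an ordinary
  primitive accessible to the fundamental theorem of calculus.\<close>

lemma power_mult_J:
  assumes "0 \<le> s"
  shows "s ^ (N - 1) * J N f s = integral {0..s} (\<lambda>t. t ^ (N - 1) * f t)"
proof (cases "s = 0")
  case False
  have "J N f s = integral {0..s} (\<lambda>t. inverse (s ^ (N - 1)) * (t ^ (N - 1) * f t))"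
    by (simp add: J_def power_mult_distrib power_inverse divide_inverse mult_ac)
  also have "\<dots> = inverse (s ^ (N - 1)) * integral {0..s} (\<lambda>t. t ^ (N - 1) * f t)"
    by (rule integral_mult_right)
  finally show ?thesis using False by simp
qed simp

lemma J_integrable:
  fixes f :: "real \<Rightarrow> real"
  assumes "continuous_on {0..1} f" "0 \<le> s" "s \<le> 1"
  shows "(\<lambda>t. (t / s) ^ (N - 1) * f t) integrable_on {0..s}"
proof (cases "s = 0")
  case False
  then show ?thesis using assms
    by (intro integrable_continuous_real continuous_intros continuous_on_subset[OF assms(1)]) auto
next
  case True
  then show ?thesis
    using integrable_on_refl[of "\<lambda>t. (t / s) ^ (N - 1) * f t" s] by (simp only: cbox_idem atLeastAtMost_singleton)
qed

lemma J_add: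
  assumes "continuous_on {0..1} f" "continuous_on {0..1} g" "0 \<le> s" "s \<le> 1"
  shows "J N (\<lambda>t. f t + g t) s = J N f s + J N g s"
  using integral_add[OF J_integrable[OF assms(1,3,4)] J_integrable[OF assms(2,3,4)]]
  by (simp add: J_def distrib_left)

lemma J_cmult: "J N (\<lambda>t. c * f t) s = c * J N f s"
proof -
  have "J N (\<lambda>t. c * f t) s = integral {0..s} (\<lambda>t. c * ((t / s) ^ (N - 1) * f t))"
    by (simp add: J_def mult_ac)
  then show ?thesis by (simp add: J_def)
qed

text \<open>The factor s is what matters near 0: it gives continuity of \<open>J N f\<close> there,
  and later it compensates the blow-up of the weight at 0.\<close>

lemma abs_J_le:
  assumes f: "continuous_on {0..1} f" "\<And>t. t \<in> {0..1} \<Longrightarrow> \<bar>f t\<bar> \<le> B" and s: "0 \<le> s" "s \<le> 1"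
  shows "\<bar>J N f s\<bar> \<le> B * s"
proof (cases "s = 0")
  case False
  have "norm (integral {0..s} (\<lambda>t. (t / s) ^ (N - 1) * f t)) \<le> B * (s - 0)"
  proof (rule integral_bound)
    show "continuous_on {0..s} (\<lambda>t. (t / s) ^ (N - 1) * f t)"
      using False s by (intro continuous_intros continuous_on_subset[OF f(1)]) auto
    show "norm ((t / s) ^ (N - 1) * f t) \<le> B" if t: "t \<in> {0..s}" for t
    proof -
      from t have "\<bar>(t / s) ^ (N - 1)\<bar> \<le> 1" "\<bar>f t\<bar> \<le> B"
        using s False by (auto intro!: power_le_one f(2) simp: power_abs)
      then have "\<bar>(t / s) ^ (N - 1)\<bar> * \<bar>f t\<bar> \<le> 1 * B"
        by (intro mult_mono) auto
      then show "norm ((t / s) ^ (N - 1) * f t) \<le> B"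
        unfolding real_norm_def abs_mult by simp
    qed
  qed (use s in auto)
  then show ?thesis by (simp add: J_def)
qed simp

lemma continuous_on_bounded_unit:
  fixes f :: "real \<Rightarrow> real"
  assumes "continuous_on {0..1} f"
  obtains B where "0 \<le> B" "\<And>t. t \<in> {0..1} \<Longrightarrow> \<bar>f t\<bar> \<le> B"
proof -
  have "bounded (f ` {0..1})"
    using assms by (intro compact_imp_bounded compact_continuous_image) auto
  then obtain B where "\<And>t. t \<in> {0..1} \<Longrightarrow> \<bar>f t\<bar> \<le> B"
    unfolding bounded_iff by fastforce
  with that[of "\<bar>B\<bar>"] show ?thesis by (meson abs_ge_self abs_ge_zero order_trans)
qed

lemma continuous_on_J:
  assumes f: "continuous_on {0..1} f"
  shows "continuous_on {0..1} (J N f)"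
  unfolding continuous_on_eq_continuous_within
proof
  fix s :: real assume s: "s \<in> {0..1}"
  show "continuous (at s within {0..1}) (J N f)"
  proof (cases "s = 0")
    case True
    obtain B where B: "\<And>t. t \<in> {0..1} \<Longrightarrow> \<bar>f t\<bar> \<le> B"
      using continuous_on_bounded_unit[OF f] by metis
    have "(J N f \<longlongrightarrow> 0) (at 0 within {0..1})"
    proof (rule Lim_null_comparison)
      show "\<forall>\<^sub>F x in at 0 within {0..1}. norm (J N f x) \<le> B * x"
        using abs_J_le[OF f B] by (auto simp: eventually_at_filter)
      show "((\<lambda>x. B * x) \<longlongrightarrow> 0) (at 0 within {0..1})"
        by (auto intro!: tendsto_eq_intros)
    qed
    then show ?thesis using True by (simp add: continuous_within)
  next
    case False
    have "continuous_on {0<..1} (\<lambda>s. integral {0..s} (\<lambda>t. t ^ (N - 1) * f t) / s ^ (N - 1))"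
      by (intro continuous_intros continuous_on_subset[OF indefinite_integral_continuous_1, of _ 0 1]
          integrable_continuous_real f) auto
    then have "continuous_on {0<..1} (J N f)"
      by (rule continuous_on_eq) (simp del: One_nat_def flip: power_mult_J)
    then have "continuous (at s within {0<..1}) (J N f)"
      using s False by (simp add: continuous_on_eq_continuous_within)
    moreover have "at s within {0..1} = at s within {0<..1}"
      using s False by (intro at_within_nhd[of s "{0<..}"]) auto
    ultimately show ?thesis by (simp add: continuous_within)
  qed
qed

lemma has_real_derivative_power_integral:
  assumes f: "continuous_on {0..1} f" and r: "0 < r" "r < 1"
  shows "((\<lambda>s. integral {0..s} (\<lambda>t. t ^ m * f t)) has_real_derivative r ^ m * f r) (at r)"
proof -
  have "((\<lambda>s. integral {0..s} (\<lambda>t. t ^ m * f t)) has_real_derivative r ^ m * f r) (at r within {0..1})"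
    using r by (intro integral_has_real_derivative continuous_intros f) auto
  then show ?thesis using at_within_unit_interval[OF r] by simp
qed

lemmas continuous_on_J_C0 = continuous_on_J[OF continuous_on_C0_fun]

lemma abs_C0_fun_le: "\<bar>C0_fun h t\<bar> \<le> norm h"
  unfolding C0_fun_def using norm_bounded[of h] by simp

lemma abs_J_C0_le: "0 \<le> s \<Longrightarrow> s \<le> 1 \<Longrightarrow> \<bar>J N (C0_fun h) s\<bar> \<le> norm h * s"
  by (rule abs_J_le[OF continuous_on_C0_fun abs_C0_fun_le])

lemma abs_J_C0_le_norm: "0 \<le> s \<Longrightarrow> s \<le> 1 \<Longrightarrow> \<bar>J N (C0_fun h) s\<bar> \<le> norm h"
  using mult_left_le[of s "norm h"] by (intro order_trans[OF abs_J_C0_le]) auto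

lemma J_C0_add: "0 \<le> s \<Longrightarrow> s \<le> 1 \<Longrightarrow> J N (C0_fun (h + k)) s = J N (C0_fun h) s + J N (C0_fun k) s"
  using J_add[OF continuous_on_C0_fun[of _ h] continuous_on_C0_fun[of _ k], where s = s and N = N]
  by (simp add: J_def)

lemma J_C0_scaleR: "J N (C0_fun (c *\<^sub>R h)) s = c * J N (C0_fun h) s"
  using J_cmult[of N c "C0_fun h" s] unfolding J_def C0_fun_scaleR .

lemma J_C0_diff: "0 \<le> s \<Longrightarrow> s \<le> 1 \<Longrightarrow> J N (C0_fun (h - k)) s = J N (C0_fun h) s - J N (C0_fun k) s"
  using J_C0_add[of s N "h - k" k] by simp

lemma p_star_eq: "1 < p \<Longrightarrow> p_star p = p_conj p - 1"
  by (simp add: p_star_def p_conj_def field_simps)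

lemma continuous_on_phi_J: "1 < q \<Longrightarrow> continuous_on {0..1} (\<lambda>s. phi q (J N (C0_fun h) s))"
  by (rule continuous_on_compose2[OF continuous_on_phi[of q UNIV] continuous_on_J_C0]) auto

lemma p_conj_gt_1: "1 < p \<Longrightarrow> 1 < p_conj p"
  by (simp add: p_conj_def field_simps)

lemma S_op_eq: "S_op N p h = I_op (\<lambda>s. phi (p_conj p) (J N (C0_fun h) s))"
  by (rule ext) (simp add: S_op_def I_op_def J_def)

lemma D01_S_op:
  assumes "1 < p" "r \<in> {0..1}"
  shows "D01 (S_op N p h) r = - phi (p_conj p) (J N (C0_fun h) r)"
proof -
  note c = continuous_on_phi_J[OF p_conj_gt_1[OF assms(1)], of N h]
  have "(S_op N p h has_real_derivative - phi (p_conj p) (J N (C0_fun h) r)) (at r within {0..1})"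
    unfolding S_op_eq
    using assms(2) c
    by (intro has_real_derivative_I_op[of "\<lambda>s. phi (p_conj p) (J N (C0_fun h) s)"] integrable_continuous_real)
      (auto simp: continuous_on_eq_continuous_within)
  then show ?thesis
    unfolding D01_def has_real_derivative_iff_has_vector_derivative
    using assms(2) by (intro vector_derivative_within_closed_interval) auto
qed

lemma abs_D01_S_op_powr:
  assumes "1 < p" "r \<in> {0..1}"
  shows "\<bar>D01 (S_op N p h) r\<bar> powr e = \<bar>J N (C0_fun h) r\<bar> powr ((p_conj p - 1) * e)"
  using assms by (simp add: D01_S_op abs_phi powr_powr)

lemma p_conj_exponent: "1 < p \<Longrightarrow> (p_conj p - 1) * (2 - p) = p_conj p - 2"
  by (simp add: p_conj_def field_simps)

lemma D01_S_op_eq_0_iff: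
  assumes "1 < p" "r \<in> {0..1}"
  shows "D01 (S_op N p h) r = 0 \<longleftrightarrow> J N (C0_fun h) r = 0"
  using assms by (simp add: D01_S_op phi_def)

text \<open>Here \<open>q\<close> stands for $p'$, so that $q - 1 = p^*$ and $|u'|^{2-p} = |J(h)|^{q-2}$, also at the zeros
  of \<open>u'\<close>, where both sides are the junk value 0 if \<open>p > 2\<close>.\<close>

definition DS_integrand :: "nat \<Rightarrow> real \<Rightarrow> C0 \<Rightarrow> C0 \<Rightarrow> real \<Rightarrow> real" where
  "DS_integrand N q h hb s = (q - 1) * \<bar>J N (C0_fun h) s\<bar> powr (q - 2) * J N (C0_fun hb) s"

lemma DS_formula_eq:
  assumes p: "1 < p" and r: "0 \<le> r"
  shows "DS_formula N p h hb r = I_op (DS_integrand N (p_conj p) h hb) r"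
proof -
  have "I_op (DS_integrand N (p_conj p) h hb) r
    = integral {r..1} (\<lambda>s. p_star p * (\<bar>D01 (S_op N p h) s\<bar> powr (2 - p) * J N (C0_fun hb) s))"
    unfolding I_op_def DS_integrand_def
    using r p
    by (intro integral_cong) (auto simp: abs_D01_S_op_powr p_conj_exponent p_star_eq mult.assoc)
  then show ?thesis by (simp add: DS_formula_def I_op_def)
qed

text \<open>Where \<open>J h\<close> does not vanish, |u'|^(p-2) cancels |J h|^(q-2), so the flux is
  -(q - 1) r^(N-1) J(hb)(r). By \<open>power_mult_J\<close> this is a primitive of a continuous
  function and extends differentiably across the zeros of u'; this extension is the witness
  \<open>w\<close>. Continuity of the integrand on the whole interval is required for p < 2 only,
  where v' = 0 has to hold at the zeros of u'.\<close>

lemma linearised_bvp_I_op: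
  assumes p: "1 < p" "p \<noteq> 2"
    and int: "DS_integrand N (p_conj p) h hb integrable_on {0..1}"
    and cont0: "continuous (at 0 within {0..1}) (DS_integrand N (p_conj p) h hb)"
    and cont: "p < 2 \<Longrightarrow> continuous_on {0..1} (DS_integrand N (p_conj p) h hb)"
    and v: "\<And>r. r \<in> {0..1} \<Longrightarrow> v r = I_op (DS_integrand N (p_conj p) h hb) r"
  shows "linearised_bvp N p (S_op N p h) (C0_fun hb) v"
proof -
  define q where "q = p_conj p"
  define F where "F = DS_integrand N q h hb"
  define w where "w = (\<lambda>r. - (q - 1) * integral {0..r} (\<lambda>t. t ^ (N - 1) * C0_fun hb t))"
  have within: "(v has_real_derivative - F r) (at r within {0..1})"
    if "r \<in> {0..1}" "continuous (at r within {0..1}) F" for r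
  proof (rule has_field_derivative_transform_within[where d = 1])
    show "(I_op F has_real_derivative - F r) (at r within {0..1})"
      using has_real_derivative_I_op[of F r] that int by (simp add: F_def q_def)
    show "I_op F x = v x" if "x \<in> {0..1}" for x using v[OF that] by (simp add: F_def q_def)
  qed (use that in auto)
  have cJ: "isCont (J N (C0_fun k)) r" if "0 < r" "r < 1" for k r
    using continuous_on_J_C0[of N k] that at_within_unit_interval[OF that]
    by (auto simp: continuous_on_eq_continuous_within dest: bspec[of _ _ r])
  have nonzero: "v differentiable (at r)" 
      "w r = r ^ (N - 1) * \<bar>D01 (S_op N p h) r\<bar> powr (p - 2) * deriv v r"
    if r: "r \<in> {0<..<1}" and nz: "D01 (S_op N p h) r \<noteq> 0" for r
  proof -
    have J: "J N (C0_fun h) r \<noteq> 0" using nz r p by (simp add: D01_S_op_eq_0_iff)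
    have "isCont F r"
      unfolding F_def DS_integrand_def
      using J r by (intro continuous_intros cJ) auto
    then have D: "(v has_real_derivative - F r) (at r)"
      using within[of r] r at_within_unit_interval[of r] by simp
    then show "v differentiable (at r)" by (rule differentiableI[OF has_field_derivative_imp_has_derivative])
    have e: "(q - 1) * (p - 2) = - (q - 2)"
      using p_conj_exponent[OF p(1)] by (simp add: q_def algebra_simps)
    have "\<bar>D01 (S_op N p h) r\<bar> powr (p - 2) * \<bar>J N (C0_fun h) r\<bar> powr (q - 2) = 1"
      using p r J by (simp add: abs_D01_S_op_powr e flip: q_def powr_add)
    then have "r ^ (N - 1) * \<bar>D01 (S_op N p h) r\<bar> powr (p - 2) * (- F r)
        = - (q - 1) * (r ^ (N - 1) * J N (C0_fun hb) r)"
      unfolding F_def DS_integrand_def by (simp add: algebra_simps)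
    also have "\<dots> = w r" using r by (simp del: One_nat_def add: w_def power_mult_J)
    finally show "w r = r ^ (N - 1) * \<bar>D01 (S_op N p h) r\<bar> powr (p - 2) * deriv v r"
      using DERIV_imp_deriv[OF D] by simp
  qed
  have zero: "(v has_real_derivative 0) (at r)"
    if r: "r \<in> {0<..<1}" and z: "D01 (S_op N p h) r = 0" "p < 2" for r
  proof -
    have "F r = 0" using z r p by (simp add: D01_S_op_eq_0_iff F_def DS_integrand_def)
    moreover have "continuous (at r within {0..1}) F"
      using cont[OF z(2)] r by (simp add: F_def q_def continuous_on_eq_continuous_within)
    ultimately show ?thesis using within[of r] r at_within_unit_interval[of r] by simp
  qed
  have flux: "(w has_real_derivative - (p_star p * r ^ (N - 1) * C0_fun hb r)) (at r)"
    if "r \<in> {0<..<1}" for r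
  proof -
    have "(w has_real_derivative - (q - 1) * (r ^ (N - 1) * C0_fun hb r)) (at r)"
      unfolding w_def using that
      by (intro DERIV_cmult has_real_derivative_power_integral continuous_on_C0_fun) auto
    then show ?thesis using p by (simp add: q_def p_star_eq algebra_simps)
  qed
  have "F 0 = 0" by (simp add: F_def DS_integrand_def)
  then have "(v has_real_derivative 0) (at 0 within {0..1})"
    using within[of 0] cont0 by (simp add: F_def q_def)
  moreover have "v 1 = 0" using v[of 1] by (simp add: I_op_def)
  ultimately show ?thesis
    unfolding linearised_bvp_def using nonzero zero flux by blast
qed

subsection \<open>The case \<open>1 < p < 2\<close>\<close>

lemma I_op_add:
  assumes "f integrable_on {0..1}" "g integrable_on {0..1}" "0 \<le> r"
  shows "I_op (\<lambda>s. f s + g s) r = I_op f r + I_op g r"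
  unfolding I_op_def using assms
  by (intro integral_add integrable_on_subinterval[of _ "{0..1}" r 1]) auto

lemma I_op_cmult: "I_op (\<lambda>s. c * f s) r = c * I_op f r"
  by (simp add: I_op_def)

lemma I_op_cong: "0 \<le> r \<Longrightarrow> (\<And>s. s \<in> {0..1} \<Longrightarrow> f s = g s) \<Longrightarrow> I_op f r = I_op g r"
  unfolding I_op_def by (intro integral_cong) auto

section \<open>Primitives vanishing at 1 as elements of \<open>C1\<close>\<close>

definition C0_of :: "(real \<Rightarrow> real) \<Rightarrow> C0" where
  "C0_of f = (SOME h. \<forall>r\<in>{0..1}. C0_fun h r = f r)"

lemma C0_fun_C0_of:
  assumes "continuous_on {0..1} f" "r \<in> {0..1}"
  shows "C0_fun (C0_of f) r = f r"
proof -
  have "\<exists>h. \<forall>r\<in>{0..1}. C0_fun h r = f r"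
    using C0_of_continuous_on[OF assms(1)] by metis
  from someI_ex[OF this] show ?thesis using assms(2) by (simp add: C0_of_def)
qed

lemma norm_C0_le:
  assumes "\<And>r. r \<in> {0..1} \<Longrightarrow> \<bar>C0_fun h r\<bar> \<le> B"
  shows "norm h \<le> B"
  using assms Rep_unit_interval by (intro norm_bound) (metis C0_fun_Rep real_norm_def)

definition primitive_C1 :: "(real \<Rightarrow> real) \<Rightarrow> C1" where
  "primitive_C1 f = Abs_C1 (C0_of (I_op f))"

context
  fixes f :: "real \<Rightarrow> real"
  assumes f: "continuous_on {0..1} f"
begin

lemma DERIV_I_op_continuous:
  "r \<in> {0..1} \<Longrightarrow> (I_op f has_real_derivative - f r) (at r within {0..1})"
  using f by (intro has_real_derivative_I_op integrable_continuous_real)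
    (auto simp: continuous_on_eq_continuous_within)

lemma C0_has_deriv_I_op: "C0_has_deriv (C0_of (I_op f)) (C0_of (\<lambda>r. - f r))"
  unfolding C0_has_deriv_def
proof
  fix r :: real assume r: "r \<in> {0..1}"
  have c: "continuous_on {0..1} (I_op f)"
    using DERIV_I_op_continuous by (intro DERIV_continuous_on)
  have "(I_op f has_real_derivative C0_fun (C0_of (\<lambda>r. - f r)) r) (at r within {0..1})"
    using DERIV_I_op_continuous[OF r] r f by (simp add: C0_fun_C0_of continuous_on_minus)
  then show "(C0_fun (C0_of (I_op f)) has_real_derivative C0_fun (C0_of (\<lambda>r. - f r)) r) (at r within {0..1})"
    by (rule has_field_derivative_transform_within[where d = 1]) (use r in \<open>auto simp: C0_fun_C0_of[OF c]\<close>)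
qed

lemma Rep_primitive_C1: "Rep_C1 (primitive_C1 f) = C0_of (I_op f)"
  unfolding primitive_C1_def using C0_has_deriv_I_op by (intro Abs_C1_inverse) auto

lemma C1_fun_primitive: "r \<in> {0..1} \<Longrightarrow> C1_fun (primitive_C1 f) r = I_op f r"
  unfolding C1_fun_def Rep_primitive_C1
  by (rule C0_fun_C0_of) (auto intro: DERIV_continuous_on DERIV_I_op_continuous)

lemma C1_deriv_primitive: "C1_deriv (primitive_C1 f) = C0_of (\<lambda>r. - f r)"
  unfolding C1_deriv.rep_eq Rep_primitive_C1 by (rule C0_deriv_eq[OF C0_has_deriv_I_op])

text \<open>The function and its derivative are each bounded by \<open>B\<close>, since the interval
  has length 1. Estimates in \<open>C1\<close> thereby reduce to sup bounds for integrands.\<close>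

lemma norm_primitive_C1_le:
  assumes B: "\<And>r. r \<in> {0..1} \<Longrightarrow> \<bar>f r\<bar> \<le> B"
  shows "norm (primitive_C1 f) \<le> 2 * B"
proof -
  have "norm (Rep_C1 (primitive_C1 f)) \<le> B"
  proof (rule norm_C0_le)
    fix r :: real assume r: "r \<in> {0..1}"
    have "norm (integral {r..1} f) \<le> B * (1 - r)"
      using r by (intro integral_bound continuous_on_subset[OF f]) (auto intro: B)
    also have "\<dots> \<le> B" using r B[of 0] by (simp add: mult_left_le)
    finally show "\<bar>C0_fun (Rep_C1 (primitive_C1 f)) r\<bar> \<le> B"
      using C1_fun_primitive[OF r] by (simp add: C1_fun_def I_op_def)
  qed
  moreover have "norm (C1_deriv (primitive_C1 f)) \<le> B"
    unfolding C1_deriv_primitive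
    by (rule norm_C0_le) (simp add: C0_fun_C0_of continuous_on_minus f B)
  ultimately show ?thesis by (simp add: norm_C1_def)
qed

end

lemma C1_eqI:
  assumes "\<And>r. r \<in> {0..1} \<Longrightarrow> C1_fun u r = C1_fun v r"
  shows "u = v"
  using C0_eqI[of "Rep_C1 u" "Rep_C1 v"] assms by (simp add: C1_fun_def Rep_C1_inject)

lemma C1_fun_add: "C1_fun (u + v) r = C1_fun u r + C1_fun v r"
  and C1_fun_scaleR: "C1_fun (c *\<^sub>R u) r = c * C1_fun u r"
  by (simp_all add: C1_fun_def plus_C1.rep_eq scaleR_C1.rep_eq)

lemma primitive_C1_add:
  assumes "continuous_on {0..1} f" "continuous_on {0..1} g"
  shows "primitive_C1 (\<lambda>s. f s + g s) = primitive_C1 f + primitive_C1 g"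
  using assms by (intro C1_eqI)
    (simp add: C1_fun_primitive continuous_on_add C1_fun_add I_op_add integrable_continuous_real)

lemma primitive_C1_scaleR:
  assumes "continuous_on {0..1} f"
  shows "primitive_C1 (\<lambda>s. c * f s) = c *\<^sub>R primitive_C1 f"
  using assms by (intro C1_eqI)
    (simp add: C1_fun_primitive continuous_on_mult_left C1_fun_scaleR I_op_cmult)

lemma primitive_C1_diff:
  assumes "continuous_on {0..1} f" "continuous_on {0..1} g"
  shows "primitive_C1 (\<lambda>s. f s - g s) = primitive_C1 f - primitive_C1 g"
  using primitive_C1_add[of "\<lambda>s. f s - g s" g] assms by (simp add: continuous_on_diff)

lemma primitive_C1_cong:
  assumes "continuous_on {0..1} f" "\<And>r. r \<in> {0..1} \<Longrightarrow> f r = g r"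
  shows "primitive_C1 f = primitive_C1 g"
proof -
  have "continuous_on {0..1} g" using assms by (rule continuous_on_eq)
  then show ?thesis
    using assms by (intro C1_eqI) (auto simp: C1_fun_primitive intro!: I_op_cong)
qed

section \<open>Continuous differentiability of the solution operator into \<open>C1\<close>\<close>

lemma abs_powr_uniformly_continuous:
  fixes a R e :: real
  assumes "0 < a" "0 < e"
  obtains \<delta> where "0 < \<delta>" "\<And>x y. \<bar>x\<bar> \<le> R \<Longrightarrow> \<bar>y - x\<bar> < \<delta> \<Longrightarrow> \<bar>\<bar>y\<bar> powr a - \<bar>x\<bar> powr a\<bar> < e"
proof -
  have "uniformly_continuous_on {- (R + 1)..R + 1} (\<lambda>x::real. \<bar>x\<bar> powr a)"
    using assms by (intro compact_uniformly_continuous continuous_on_abs_powr) auto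
  then obtain d where d: "0 < d" 
    "\<And>x y. x \<in> {- (R + 1)..R + 1} \<Longrightarrow> y \<in> {- (R + 1)..R + 1} \<Longrightarrow> dist y x < d \<Longrightarrow>
      dist (\<bar>y\<bar> powr a) (\<bar>x\<bar> powr a) < e"
    using assms(2) unfolding uniformly_continuous_on_def by meson
  show ?thesis
  \<comment> \<open>The cut at 1 keeps y inside [-(R+1), R+1], so that only x needs an a priori
    bound.\<close>
  proof (rule that[of "min d 1"])
    fix x y :: real assume "\<bar>x\<bar> \<le> R" "\<bar>y - x\<bar> < min d 1"
    then show "\<bar>\<bar>y\<bar> powr a - \<bar>x\<bar> powr a\<bar> < e"
      using d(2)[of x y] unfolding dist_real_def atLeastAtMost_iff by linarith
  qed (use d in auto)
qed

text \<open>By the mean value theorem the remainder is \<open>y - x\<close> times an increment of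
  the derivative, which is small uniformly on bounded sets. Since \<open>\<delta>\<close> depends on
  x only through \<open>R\<close>, the estimate applies to all values of \<open>J h\<close> at
  once.\<close>

lemma phi_remainder_small:
  fixes q R e :: real
  assumes "2 < q" "0 < e"
  obtains \<delta> where "0 < \<delta>" "\<And>x y. \<bar>x\<bar> \<le> R \<Longrightarrow> \<bar>y - x\<bar> < \<delta> \<Longrightarrow>
    \<bar>phi q y - phi q x - (q - 1) * \<bar>x\<bar> powr (q - 2) * (y - x)\<bar> \<le> e * \<bar>y - x\<bar>"
proof -
  obtain \<delta> where d: "0 < \<delta>" "\<And>x y. \<bar>x\<bar> \<le> R \<Longrightarrow> \<bar>y - x\<bar> < \<delta> \<Longrightarrow> 
      \<bar>\<bar>y\<bar> powr (q - 2) - \<bar>x\<bar> powr (q - 2)\<bar> < e / (q - 1)"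
    using abs_powr_uniformly_continuous[of "q - 2" "e / (q - 1)" R] assms by auto
  show ?thesis
  proof (rule that[OF d(1)])
    fix x y :: real assume xy: "\<bar>x\<bar> \<le> R" "\<bar>y - x\<bar> < \<delta>"
    have "\<exists>z. \<bar>z - x\<bar> \<le> \<bar>y - x\<bar> \<and> phi q y - phi q x = (y - x) * ((q - 1) * \<bar>z\<bar> powr (q - 2))"
    proof (rule linorder_cases[of x y])
      assume "x < y"
      then obtain z where "x < z" "z < y" "phi q y - phi q x = (y - x) * ((q - 1) * \<bar>z\<bar> powr (q - 2))"
        using MVT2[of x y "phi q" "\<lambda>z. (q - 1) * \<bar>z\<bar> powr (q - 2)"] DERIV_phi[OF assms(1)] by blast
      then show ?thesis by (intro exI[of _ z]) auto
    next
      assume "y < x"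
      then obtain z where "y < z" "z < x" "phi q x - phi q y = (x - y) * ((q - 1) * \<bar>z\<bar> powr (q - 2))"
        using MVT2[of y x "phi q" "\<lambda>z. (q - 1) * \<bar>z\<bar> powr (q - 2)"] DERIV_phi[OF assms(1)] by blast
      then show ?thesis by (intro exI[of _ z]) (auto simp: algebra_simps)
    qed auto
    then obtain z where z: "\<bar>z - x\<bar> \<le> \<bar>y - x\<bar>"
      "phi q y - phi q x = (y - x) * ((q - 1) * \<bar>z\<bar> powr (q - 2))" by blast
    have "phi q y - phi q x - (q - 1) * \<bar>x\<bar> powr (q - 2) * (y - x)
        = (q - 1) * (\<bar>z\<bar> powr (q - 2) - \<bar>x\<bar> powr (q - 2)) * (y - x)"
      unfolding z(2) by (simp add: algebra_simps)
    then have "\<bar>phi q y - phi q x - (q - 1) * \<bar>x\<bar> powr (q - 2) * (y - x)\<bar>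
        = (q - 1) * \<bar>\<bar>z\<bar> powr (q - 2) - \<bar>x\<bar> powr (q - 2)\<bar> * \<bar>y - x\<bar>"
      using assms by (simp add: abs_mult)
    also have "\<dots> \<le> (q - 1) * (e / (q - 1)) * \<bar>y - x\<bar>"
      using d(2)[of x z] xy z(1) assms by (intro mult_mono) auto
    finally show "\<bar>phi q y - phi q x - (q - 1) * \<bar>x\<bar> powr (q - 2) * (y - x)\<bar> \<le> e * \<bar>y - x\<bar>"
      using assms by simp
  qed
qed

lemma DS_integrand_add:
  assumes "s \<in> {0..1}"
  shows "DS_integrand N q h (k + l) s = DS_integrand N q h k s + DS_integrand N q h l s"
  using assms by (simp add: DS_integrand_def J_C0_add algebra_simps)

lemma DS_integrand_scaleR: "DS_integrand N q h (c *\<^sub>R k) s = c * DS_integrand N q h k s"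
  by (simp add: DS_integrand_def J_C0_scaleR)

lemma continuous_on_DS_integrand:
  assumes "2 < q"
  shows "continuous_on {0..1} (DS_integrand N q h hb)"
  unfolding DS_integrand_def
  using assms by (intro continuous_intros continuous_on_J_C0
      continuous_on_compose2[OF continuous_on_abs_powr[of "q - 2" UNIV] continuous_on_J_C0]) auto

definition S_C1 :: "nat \<Rightarrow> real \<Rightarrow> C0 \<Rightarrow> C1" where
  "S_C1 N q h = primitive_C1 (\<lambda>s. phi q (J N (C0_fun h) s))"

definition DS_C1 :: "nat \<Rightarrow> real \<Rightarrow> C0 \<Rightarrow> C0 \<Rightarrow>\<^sub>L C1" where
  "DS_C1 N q h = Blinfun (\<lambda>hb. primitive_C1 (DS_integrand N q h hb))"

context
  fixes N :: nat and q :: real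
  assumes q: "2 < q"
begin

text \<open>\<open>Blinfun\<close> is meaningful only for bounded linear maps. Boundedness follows
  from the sup bound \<open>norm h\<close> for \<open>J h\<close> and the positive exponent q -
  2.\<close>

lemma DS_C1_apply: "blinfun_apply (DS_C1 N q h) hb = primitive_C1 (DS_integrand N q h hb)"
proof -
  note c = continuous_on_DS_integrand[OF q]
  have "bounded_linear (\<lambda>hb. primitive_C1 (DS_integrand N q h hb))"
  proof (rule bounded_linear_intro)
    fix k l :: C0 and r :: real
    show "primitive_C1 (DS_integrand N q h (k + l))
      = primitive_C1 (DS_integrand N q h k) + primitive_C1 (DS_integrand N q h l)"
      by (subst primitive_C1_add[symmetric])
        (auto intro!: primitive_C1_cong c simp: DS_integrand_add)
    show "primitive_C1 (DS_integrand N q h (r *\<^sub>R k)) = r *\<^sub>R primitive_C1 (DS_integrand N q h k)"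
      by (subst primitive_C1_scaleR[symmetric])
        (auto intro!: primitive_C1_cong c simp: DS_integrand_scaleR)
    have "norm (primitive_C1 (DS_integrand N q h k)) \<le> 2 * ((q - 1) * norm h powr (q - 2) * norm k)"
    proof (rule norm_primitive_C1_le[OF c])
      fix s :: real assume "s \<in> {0..1}"
      then show "\<bar>DS_integrand N q h k s\<bar> \<le> (q - 1) * norm h powr (q - 2) * norm k"
        unfolding DS_integrand_def abs_mult using q
        by (auto intro!: mult_mono powr_mono2 abs_J_C0_le_norm)
    qed
    then show "norm (primitive_C1 (DS_integrand N q h k)) \<le> norm k * (2 * (q - 1) * norm h powr (q - 2))"
      by (simp add: algebra_simps)
  qed
  then show ?thesis by (simp add: DS_C1_def bounded_linear_Blinfun_apply)
qed

lemma has_derivative_S_C1: "(S_C1 N q has_derivative blinfun_apply (DS_C1 N q h)) (at h)"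
  unfolding has_derivative_at_alt
proof (intro conjI allI impI)
  show "bounded_linear (blinfun_apply (DS_C1 N q h))" by (rule blinfun.bounded_linear_right)
  fix e :: real assume e: "0 < e"
  \<comment> \<open>Half of \<open>e\<close>, because the \<open>C1\<close> norm of a primitive
    doubles the sup bound of the integrand; \<open>norm h\<close> bounds \<open>J h\<close> on the
    unit interval.\<close>
  obtain \<delta> where d: "0 < \<delta>" "\<And>x y. \<bar>x\<bar> \<le> norm h \<Longrightarrow> \<bar>y - x\<bar> < \<delta> \<Longrightarrow>
    \<bar>phi q y - phi q x - (q - 1) * \<bar>x\<bar> powr (q - 2) * (y - x)\<bar> \<le> (e / 2) * \<bar>y - x\<bar>"
    using phi_remainder_small[OF q, of "e / 2" "norm h"] e by auto
  show "\<exists>d>0. \<forall>y. norm (y - h) < d \<longrightarrow>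
    norm (S_C1 N q y - S_C1 N q h - blinfun_apply (DS_C1 N q h) (y - h)) \<le> e * norm (y - h)"
  proof (intro exI[of _ \<delta>] conjI allI impI d(1))
    fix y assume y: "norm (y - h) < \<delta>"
    note c = continuous_on_phi_J[of q N] continuous_on_DS_integrand[OF q, of N]
    have "S_C1 N q y - S_C1 N q h - blinfun_apply (DS_C1 N q h) (y - h) =
      primitive_C1 (\<lambda>s. phi q (J N (C0_fun y) s) - phi q (J N (C0_fun h) s) - DS_integrand N q h (y - h) s)"
      unfolding S_C1_def DS_C1_apply using q c by (simp add: primitive_C1_diff continuous_on_diff)
    also have "norm \<dots> \<le> 2 * (e / 2 * norm (y - h))"
    proof (rule norm_primitive_C1_le)
      fix s :: real assume s: "s \<in> {0..1}"
      have n: "\<bar>J N (C0_fun y) s - J N (C0_fun h) s\<bar> \<le> norm (y - h)"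
        using abs_J_C0_le_norm[of s N "y - h"] s by (simp add: J_C0_diff)
      have "\<bar>phi q (J N (C0_fun y) s) - phi q (J N (C0_fun h) s) - DS_integrand N q h (y - h) s\<bar>
          \<le> e / 2 * \<bar>J N (C0_fun y) s - J N (C0_fun h) s\<bar>"
        using d(2)[of "J N (C0_fun h) s" "J N (C0_fun y) s"] s y n abs_J_C0_le_norm[of s N h]
        by (simp add: DS_integrand_def J_C0_diff)
      also have "\<dots> \<le> e / 2 * norm (y - h)"
        using n e by (intro mult_left_mono) auto
      finally show "\<bar>phi q (J N (C0_fun y) s) - phi q (J N (C0_fun h) s) - DS_integrand N q h (y - h) s\<bar>
          \<le> e / 2 * norm (y - h)" .
    qed (use q c in \<open>auto intro!: continuous_on_diff\<close>)
    finally show "norm (S_C1 N q y - S_C1 N q h - blinfun_apply (DS_C1 N q h) (y - h)) \<le> e * norm (y - h)" by simp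
  qed
qed

lemma continuous_on_DS_C1: "continuous_on UNIV (DS_C1 N q)"
  unfolding continuous_on_iff
proof (intro ballI allI impI)
  fix h :: C0 and e :: real assume e: "0 < e"
  \<comment> \<open>The integrand contributes a factor q - 1 and the \<open>C1\<close> norm a factor
    2, which leaves e / 2 for the operator norm and hence a strict inequality at the end.\<close>
  obtain \<delta> where d: "0 < \<delta>" "\<And>x y. \<bar>x\<bar> \<le> norm h \<Longrightarrow> \<bar>y - x\<bar> < \<delta> \<Longrightarrow>
    \<bar>\<bar>y\<bar> powr (q - 2) - \<bar>x\<bar> powr (q - 2)\<bar> < e / (4 * (q - 1))"
    using abs_powr_uniformly_continuous[of "q - 2" "e / (4 * (q - 1))" "norm h"] e q by auto
  show "\<exists>d>0. \<forall>y\<in>UNIV. dist y h < d \<longrightarrow> dist (DS_C1 N q y) (DS_C1 N q h) < e"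
  proof (intro exI[of _ \<delta>] conjI ballI impI d(1))
    fix y assume y: "dist y h < \<delta>"
    have "norm (DS_C1 N q y - DS_C1 N q h) \<le> e / 2"
    proof (rule norm_blinfun_bound)
      fix k
      note c = continuous_on_DS_integrand[OF q, of N]
      have "blinfun_apply (DS_C1 N q y - DS_C1 N q h) k = primitive_C1 (\<lambda>s. DS_integrand N q y k s - DS_integrand N q h k s)"
        by (simp add: blinfun.diff_left DS_C1_apply primitive_C1_diff c)
      also have "norm \<dots> \<le> 2 * (e / 4 * norm k)"
      proof (rule norm_primitive_C1_le)
        fix s :: real assume s: "s \<in> {0..1}"
        have "\<bar>J N (C0_fun y) s - J N (C0_fun h) s\<bar> \<le> norm (y - h)"
          using abs_J_C0_le_norm[of s N "y - h"] s by (simp add: J_C0_diff)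
        then have *: "\<bar>\<bar>J N (C0_fun y) s\<bar> powr (q - 2) - \<bar>J N (C0_fun h) s\<bar> powr (q - 2)\<bar> < e / (4 * (q - 1))"
          using s y abs_J_C0_le_norm[of s N h] by (intro d(2)) (auto simp: dist_norm)
        have "DS_integrand N q y k s - DS_integrand N q h k s =
          (q - 1) * (\<bar>J N (C0_fun y) s\<bar> powr (q - 2) - \<bar>J N (C0_fun h) s\<bar> powr (q - 2)) * J N (C0_fun k) s"
          by (simp add: DS_integrand_def algebra_simps)
        also have "\<bar>\<dots>\<bar> \<le> (q - 1) * (e / (4 * (q - 1))) * norm k"
          unfolding abs_mult using * s q e by (intro mult_mono abs_J_C0_le_norm) auto
        also have "\<dots> = e / 4 * norm k" using q by (simp add: divide_simps)
        finally show "\<bar>DS_integrand N q y k s - DS_integrand N q h k s\<bar> \<le> e / 4 * norm k" .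
      qed (auto intro!: continuous_on_diff c)
      finally show "norm (blinfun_apply (DS_C1 N q y - DS_C1 N q h) k) \<le> e / 2 * norm k" by simp
    qed (use e in auto)
    then show "dist (DS_C1 N q y) (DS_C1 N q h) < e" using e by (simp add: dist_norm)
  qed
qed

end

text \<open>Singular, because the coefficient |u'|^(p-2) of the linearised equation is infinite at
  the zeros of u' when p < 2.\<close>

lemma S_op_C1_singular:
  assumes p: "1 < p" "p < 2"
  shows "\<exists>(S :: C0 \<Rightarrow> C1) (DS :: C0 \<Rightarrow> C0 \<Rightarrow>\<^sub>L C1).
          (\<forall>h. \<forall>r\<in>{0..1}. C1_fun (S h) r = S_op N p h r) \<and>
          C1_map_on UNIV S DS \<and>
          (\<forall>h hb. (\<forall>r\<in>{0..1}. C1_fun (DS h hb) r = DS_formula N p h hb r) \<and>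
                  linearised_bvp N p (S_op N p h) (C0_fun hb) (C1_fun (DS h hb)))"
proof (intro exI conjI allI ballI)
  define q where "q = p_conj p"
  have q: "2 < q" using p by (simp add: q_def p_conj_def field_simps)
  fix h hb :: C0
  note c = continuous_on_DS_integrand[OF q, of N h hb]
  show "C1_fun (S_C1 N q h) r = S_op N p h r" if "r \<in> {0..1}" for r
    using that q by (simp add: S_C1_def C1_fun_primitive continuous_on_phi_J S_op_eq flip: q_def)
  show "C1_map_on UNIV (S_C1 N q) (DS_C1 N q)"
    using has_derivative_S_C1[OF q] continuous_on_DS_C1[OF q] by (simp add: C1_map_on_def)
  have *: "C1_fun (blinfun_apply (DS_C1 N q h) hb) r = I_op (DS_integrand N q h hb) r" if "r \<in> {0..1}" for r
    using that by (simp add: DS_C1_apply[OF q] C1_fun_primitive c)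
  then show "C1_fun (blinfun_apply (DS_C1 N q h) hb) r = DS_formula N p h hb r" if "r \<in> {0..1}" for r
    using that p by (simp add: DS_formula_eq q_def)
  show "linearised_bvp N p (S_op N p h) (C0_fun hb) (C1_fun (DS_C1 N q h hb))"
    using p c * by (intro linearised_bvp_I_op) 
      (auto simp flip: q_def intro!: integrable_continuous_real simp: continuous_on_eq_continuous_within)
qed

subsection \<open>Linear lower bounds near the zeros of \<open>J h\<close>\<close>

text \<open>Integrated form of \<open>(t\<^sup>N\<^sup>-\<^sup>1 J f)' = t\<^sup>N\<^sup>-\<^sup>1 f\<close>.\<close>

lemma power_mult_J_increment:
  assumes f: "continuous_on {0..1} f" "\<And>t. t \<in> {l..r} \<Longrightarrow> c \<le> f t" and c: "0 \<le> c"
    and st: "0 \<le> l" "l \<le> s" "s \<le> t" "t \<le> r" "r \<le> 1"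
  shows "c / real (Suc (N - 1)) * (t ^ (N - 1) * (t - s)) \<le> t ^ (N - 1) * J N f t - s ^ (N - 1) * J N f s"
proof -
  define m where "m = N - 1"
  \<comment> \<open>The subtracted monomial is a primitive of c x^m, so the derivative of
    \<open>F\<close> is x^m (f(x) - c), which is nonnegative.\<close>
  define F where "F = (\<lambda>x. integral {0..x} (\<lambda>t. t ^ m * f t) - c / real (Suc m) * x ^ Suc m)"
  have pow: "((\<lambda>x. x ^ Suc m) has_real_derivative real (Suc m) * x ^ m) (at x)" for x :: real
    using DERIV_pow[of "Suc m" x] by (simp del: of_nat_Suc power_Suc)
  have "F s \<le> F t"
  proof (rule DERIV_nonneg_imp_increasing_open[OF st(3)])
    fix x assume x: "s < x" "x < t"
    have "(F has_real_derivative x ^ m * f x - c / real (Suc m) * (real (Suc m) * x ^ m)) (at x)"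
      unfolding F_def using x st f
      by (intro DERIV_diff has_real_derivative_power_integral DERIV_cmult pow) auto
    moreover have "x ^ m * f x - c / real (Suc m) * (real (Suc m) * x ^ m) = x ^ m * (f x - c)"
      by (simp add: algebra_simps del: of_nat_Suc)
    moreover have "0 \<le> x ^ m * (f x - c)" using x st f(2)[of x] by auto
    ultimately show "\<exists>y. (F has_real_derivative y) (at x) \<and> 0 \<le> y" by metis
  next
    have "continuous_on {0..1} F" unfolding F_def
      by (intro continuous_intros indefinite_integral_continuous_1 integrable_continuous_real f(1))
    then show "continuous_on {s..t} F" by (rule continuous_on_subset) (use st in auto)
  qed
  then have "c / real (Suc m) * (t ^ Suc m - s ^ Suc m) \<le> t ^ m * J N f t - s ^ m * J N f s"
    using power_mult_J[of t N f] power_mult_J[of s N f] st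
    by (simp add: F_def m_def right_diff_distrib del: One_nat_def of_nat_Suc power_Suc)
  \<comment> \<open>This trades the difference of powers for a product with \<open>t ^ m\<close>,
    which can later be cancelled to leave a bound linear in t - s.\<close>
  moreover have "t ^ m * (t - s) \<le> t ^ Suc m - s ^ Suc m"
  proof -
    have "s ^ m * s \<le> t ^ m * s" using st by (intro mult_right_mono power_mono) auto
    then show ?thesis by (simp add: algebra_simps)
  qed
  then have "c / real (Suc m) * (t ^ m * (t - s)) \<le> c / real (Suc m) * (t ^ Suc m - s ^ Suc m)"
    using c by (intro mult_left_mono) auto
  ultimately show ?thesis unfolding m_def by linarith
qed

text \<open>The function t^(N-1) J f(t) is nondecreasing, so J f keeps a nonnegative sign to the
  right of a point and a nonpositive sign to its left. The point z is a zero if J f changes sign on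
  the interval, and otherwise the end point at which |J f| starts to grow: l if J f is nonnegative
  there, r if J f is nonpositive there.\<close>

lemma J_linear_lower_bound_pos:
  assumes f: "continuous_on {0..1} f" "\<And>t. t \<in> {l..r} \<Longrightarrow> c \<le> f t" and c: "0 \<le> c"
    and lr: "0 \<le> l" "l \<le> r" "r \<le> 1"
  shows "\<exists>z\<in>{l..r}. \<forall>t\<in>{l..r}. c / real (Suc (N - 1)) * \<bar>t - z\<bar> \<le> \<bar>J N f t\<bar>"
proof -
  define c' where "c' = c / real (Suc (N - 1))"
  have inc: "c' * (t ^ (N - 1) * (t - s)) \<le> t ^ (N - 1) * J N f t - s ^ (N - 1) * J N f s"
    if "l \<le> s" "s \<le> t" "t \<le> r" for s t
    unfolding c'_def using power_mult_J_increment[of f l r c s t N] f c lr that by blast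
  have c': "0 \<le> c'" using c by (simp add: c'_def)
  have right: "c' * \<bar>t - z\<bar> \<le> \<bar>J N f t\<bar>" if z: "l \<le> z" "z \<le> t" "t \<le> r" "0 \<le> J N f z" for z t
  proof (cases "t = 0")
    case True
    with z lr have "z = 0" by linarith
    with True show ?thesis by simp
  next
    case False
    then have t: "0 < t ^ (N - 1)" using lr z by auto
    have "0 \<le> z ^ (N - 1) * J N f z" using z lr by auto
    then have "t ^ (N - 1) * (c' * (t - z)) \<le> t ^ (N - 1) * J N f t"
      using inc[OF z(1-3)] by (simp add: algebra_simps)
    then have "c' * (t - z) \<le> J N f t" using t by (simp only: mult_le_cancel_left_pos)
    then show ?thesis using z by simp
  qed
  \<comment> \<open>Here the increment bound carries the larger power z^(N-1). It is lowered to
    t^(N-1) and then cancelled, for which t must be positive.\<close>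
  have left: "c' * \<bar>t - z\<bar> \<le> \<bar>J N f t\<bar>" if z: "l \<le> t" "t \<le> z" "z \<le> r" "J N f z \<le> 0" and l: "0 < l" for z t
  proof -
    have t: "0 < t ^ (N - 1)" using l z by auto
    have "z ^ (N - 1) * J N f z \<le> 0" using z l by (intro mult_nonneg_nonpos) auto
    moreover have "c' * (t ^ (N - 1) * (z - t)) \<le> c' * (z ^ (N - 1) * (z - t))"
      using c' z l by (intro mult_left_mono mult_right_mono power_mono) auto
    ultimately have "t ^ (N - 1) * (c' * (z - t)) \<le> t ^ (N - 1) * (- J N f t)"
      using inc[OF z(1-3)] by (simp add: algebra_simps)
    then have "c' * (z - t) \<le> - J N f t" using t by (simp only: mult_le_cancel_left_pos)
    then show ?thesis using z by simp
  qed
  \<comment> \<open>An interval starting at 0 always falls under the first case, since J f vanishes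
    at 0; hence \<open>left\<close> is never applied there.\<close>
  consider "0 \<le> J N f l" | "0 < l" "J N f r \<le> 0" | "0 < l" "J N f l \<le> 0" "0 \<le> J N f r"
  proof (cases "l = 0")
    case False
    then show ?thesis using that lr by linarith
  qed (use that in simp)
  then have "\<exists>z\<in>{l..r}. \<forall>t\<in>{l..r}. c' * \<bar>t - z\<bar> \<le> \<bar>J N f t\<bar>"
  proof cases
    case 1 then show ?thesis using right[of l] lr by (intro bexI[of _ l]) auto
  next
    case 2 then show ?thesis using left[of _ r] lr by (intro bexI[of _ r]) auto
  next
    case 3
    have "continuous_on {l..r} (J N f)"
      by (rule continuous_on_subset[OF continuous_on_J[OF f(1)]]) (use lr in auto)
    then obtain z where z: "l \<le> z" "z \<le> r" "J N f z = 0"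
      using IVT'[of "J N f" l 0 r] 3 lr by auto
    have "c' * \<bar>t - z\<bar> \<le> \<bar>J N f t\<bar>" if "t \<in> {l..r}" for t
      using left[of t z] right[of z t] z 3 that by (cases "t \<le> z") auto
    then show ?thesis using z by (intro bexI[of _ z]) auto
  qed
  then show ?thesis by (simp only: c'_def)
qed

lemma J_linear_lower_bound:
  assumes f: "continuous_on {0..1} f" 
    and sgn: "(\<forall>t\<in>{l..r}. c \<le> f t) \<or> (\<forall>t\<in>{l..r}. f t \<le> - c)" and c: "0 \<le> c"
    and lr: "0 \<le> l" "l \<le> r" "r \<le> 1"
  shows "\<exists>z\<in>{l..r}. \<forall>t\<in>{l..r}. c / real (Suc (N - 1)) * \<bar>t - z\<bar> \<le> \<bar>J N f t\<bar>"
  using sgn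
proof
  assume "\<forall>t\<in>{l..r}. c \<le> f t"
  then show ?thesis using J_linear_lower_bound_pos[OF f _ c lr] by blast
next
  assume *: "\<forall>t\<in>{l..r}. f t \<le> - c"
  have "continuous_on {0..1} (\<lambda>t. (- 1) * f t)" using f by (intro continuous_intros)
  moreover have "c \<le> (- 1) * f t" if "t \<in> {l..r}" for t using * that by fastforce
  ultimately show ?thesis
    using J_linear_lower_bound_pos[of "\<lambda>t. (- 1) * f t" l r c N] c lr unfolding J_cmult by simp
qed

lemma unit_interval_subdivision:
  fixes s :: real and n :: nat
  assumes "0 < n" "0 \<le> s" "s \<le> 1"
  obtains i where "i < n" "real i / real n \<le> s" "s \<le> real (Suc i) / real n"
proof (cases "s = 1")
  \<comment> \<open>At s = 1 the floor used below would be n, one past the last cell.\<close>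
  case True
  then show ?thesis using that[of "n - 1"] assms by (simp add: field_simps)
next
  case False
  define i where "i = nat \<lfloor>s * real n\<rfloor>"
  have "real i = real_of_int \<lfloor>s * real n\<rfloor>" using assms by (simp add: i_def)
  then have i: "real i \<le> s * real n" "s * real n < real i + 1" by linarith+
  moreover have "s * real n < real n" using False assms by simp
  ultimately have "real i < real n" by linarith
  then have "i < n" by simp
  moreover have "real i / real n \<le> s" using i(1) assms(1) by (simp add: pos_divide_le_eq)
  moreover have "s \<le> real (Suc i) / real n" using i(2) assms(1) by (simp add: pos_le_divide_eq)
  ultimately show ?thesis by (rule that)
qed

text \<open>The points \<open>z i\<close> need not be zeros of \<open>g\<close>. They may depend on \<open>g\<close>, but \<open>\<kappa>\<close> and \<open>n\<close> stay fixed
  on a whole neighbourhood of \<open>h\<^sub>0\<close> below, which makes the integral bounds uniform.\<close>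

definition linearly_vanishing :: "real \<Rightarrow> nat \<Rightarrow> (real \<Rightarrow> real) \<Rightarrow> bool" where
  "linearly_vanishing \<kappa> n g \<longleftrightarrow> (\<exists>z. (\<forall>i<n. z i \<in> {0..1}) \<and>
      (\<forall>s\<in>{0..1}. \<exists>i<n. \<kappa> * \<bar>s - z i\<bar> \<le> \<bar>g s\<bar>))"

text \<open>The hypothesis says that the continuous function max(|J h0|, |h0|) is positive;
  compactness makes it bounded away from 0. Such a quantitative bound survives small perturbations
  of h0 in the sup norm.\<close>

lemma J_linear_lower_bound_uniform:
  assumes h0: "\<And>r. r \<in> {0..1} \<Longrightarrow> J N (C0_fun h0) r = 0 \<Longrightarrow> C0_fun h0 r \<noteq> 0"
  shows "\<exists>\<kappa>>0. \<exists>e>0. \<exists>n. \<forall>h\<in>ball h0 e. linearly_vanishing \<kappa> n (J N (C0_fun h))"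
proof -
  define g where "g = J N (C0_fun h0)"
  define f where "f = C0_fun h0"
  have cont: "continuous_on {0..1} g" "continuous_on {0..1} f"
    unfolding g_def f_def by (rule continuous_on_J_C0 continuous_on_C0_fun)+
  have "\<exists>x\<in>{0..1}. \<forall>y\<in>{0..1::real}. max \<bar>g x\<bar> \<bar>f x\<bar> \<le> max \<bar>g y\<bar> \<bar>f y\<bar>"
    by (rule continuous_attains_inf) (auto intro!: continuous_on_max continuous_on_rabs cont)
  then obtain x where x: "x \<in> {0..1}" "\<And>y. y \<in> {0..1} \<Longrightarrow> max \<bar>g x\<bar> \<bar>f x\<bar> \<le> max \<bar>g y\<bar> \<bar>f y\<bar>"
    by blast
  \<comment> \<open>The minimum is 3 c: one c is lost to the oscillation within a cell, one to the
    distance between h and h0, which also controls J h - J h0, and one remains.\<close>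
  define c where "c = max \<bar>g x\<bar> \<bar>f x\<bar> / 3"
  have c: "0 < c" using h0[OF x(1)] by (auto simp: c_def g_def f_def less_max_iff_disj)
  have "uniformly_continuous_on {0..1} g" "uniformly_continuous_on {0..1} f"
    using cont by (auto intro: compact_uniformly_continuous)
  then obtain d1 d2 where d: "0 < d1" "0 < d2"
    "\<And>s t. s \<in> {0..1} \<Longrightarrow> t \<in> {0..1} \<Longrightarrow> dist t s < d1 \<Longrightarrow> dist (g t) (g s) < c"
    "\<And>s t. s \<in> {0..1} \<Longrightarrow> t \<in> {0..1} \<Longrightarrow> dist t s < d2 \<Longrightarrow> dist (f t) (f s) < c"
    using uniformly_continuous_onE[of "{0..1}" g c] uniformly_continuous_onE[of "{0..1}" f c] c
    by (smt (verit, ccfv_threshold))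
  obtain n where n: "0 < n" "1 / real n < min d1 d2"
    proof -
    have "0 < min d1 d2" using d by simp
    then obtain n where "1 / real (Suc n) < min d1 d2" by (rule nat_approx_posE)
    then show ?thesis by (intro that[of "Suc n"]) auto
  qed
  define \<kappa> where "\<kappa> = c / real (Suc (N - 1))"
  have k: "0 < \<kappa>" "\<kappa> \<le> c" using c by (auto simp: \<kappa>_def divide_le_eq)
  show ?thesis
  proof (rule exI[of _ \<kappa>], rule conjI[OF k(1)], rule exI[of _ c], rule conjI[OF c], rule exI[of _ n], rule ballI)
    fix h assume "h \<in> ball h0 c"
    then have h: "norm (h - h0) < c" by (simp add: dist_norm norm_minus_commute)
    have "\<exists>z\<in>{0..1}. \<forall>t\<in>{real i / real n..real (Suc i) / real n}. \<kappa> * \<bar>t - z\<bar> \<le> \<bar>J N (C0_fun h) t\<bar>"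
      if i: "i < n" for i
    proof -
      define l r where "l = real i / real n" and "r = real (Suc i) / real n"
      have "real (Suc i) \<le> real n" using i by linarith
      then have lr: "0 \<le> l" "l \<le> r" "r \<le> 1" using i by (auto simp: l_def r_def divide_right_mono)
      have near: "dist (g t) (g l) < c" "dist (f t) (f l) < c" if "t \<in> {l..r}" for t
      proof -
        have "r - l = 1 / real n" by (simp add: l_def r_def add_divide_distrib)
        then have "dist t l < min d1 d2" using that n(2) by (simp add: dist_real_def)
        then show "dist (g t) (g l) < c" "dist (f t) (f l) < c" using that lr d by auto
      qed
      have J: "\<bar>J N (C0_fun h) t - g t\<bar> < c" if "t \<in> {l..r}" for t
        using abs_J_C0_le_norm[of t N "h - h0"] h that lr by (simp add: g_def J_C0_diff)
      have F: "\<bar>C0_fun h t - f t\<bar> < c" for t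
        using abs_C0_fun_le[of "h - h0" t] h by (simp add: f_def)
      have "3 * c \<le> max \<bar>g l\<bar> \<bar>f l\<bar>" using x(2)[of l] lr by (simp add: c_def)
      then consider "3 * c \<le> \<bar>g l\<bar>" | "3 * c \<le> f l" | "f l \<le> - (3 * c)" by linarith
      then have "\<exists>z\<in>{l..r}. \<forall>t\<in>{l..r}. \<kappa> * \<bar>t - z\<bar> \<le> \<bar>J N (C0_fun h) t\<bar>"
      proof cases
        case 1
        \<comment> \<open>On this cell |J h| exceeds c, and \<kappa> |t - l| cannot exceed c; any
          point of the cell would serve as z.\<close>
        have "\<kappa> * \<bar>t - l\<bar> \<le> \<bar>J N (C0_fun h) t\<bar>" if t: "t \<in> {l..r}" for t
        proof -
          have "\<kappa> * \<bar>t - l\<bar> \<le> c * 1" using k t lr by (intro mult_mono) auto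
          then show ?thesis using near(1)[OF t] J[OF t] 1 by (simp add: dist_real_def)
        qed
        then show ?thesis using lr by (intro bexI[of _ l]) auto
      next
        case 2
        have "c \<le> C0_fun h t" if t: "t \<in> {l..r}" for t
          using near(2)[OF t] F[of t] 2 by (simp add: dist_real_def)
        then show ?thesis unfolding \<kappa>_def
          using c lr by (intro J_linear_lower_bound continuous_on_C0_fun) auto
      next
        case 3
        have "C0_fun h t \<le> - c" if t: "t \<in> {l..r}" for t
          using near(2)[OF t] F[of t] 3 by (simp add: dist_real_def)
        then show ?thesis unfolding \<kappa>_def
          using c lr by (intro J_linear_lower_bound continuous_on_C0_fun) auto
      qed
      then obtain z where "z \<in> {l..r}" "\<forall>t\<in>{l..r}. \<kappa> * \<bar>t - z\<bar> \<le> \<bar>J N (C0_fun h) t\<bar>" by blast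
      moreover have "z \<in> {0..1}" using lr calculation(1) by auto
      ultimately show ?thesis unfolding l_def r_def by blast
    qed
    then obtain z where z: "\<And>i. i < n \<Longrightarrow> z i \<in> {0..1} \<and>
      (\<forall>t\<in>{real i / real n..real (Suc i) / real n}. \<kappa> * \<bar>t - z i\<bar> \<le> \<bar>J N (C0_fun h) t\<bar>)"
      by metis
    have "\<exists>i<n. \<kappa> * \<bar>s - z i\<bar> \<le> \<bar>J N (C0_fun h) s\<bar>" if s: "s \<in> {0..1}" for s
    proof -
      obtain i where "i < n" "real i / real n \<le> s" "s \<le> real (Suc i) / real n"
        using unit_interval_subdivision[OF n(1), of s] s by auto
      then show ?thesis using z[of i] by auto
    qed
    then show "linearly_vanishing \<kappa> n (J N (C0_fun h))"
      unfolding linearly_vanishing_def using z by blast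
  qed
qed

subsection \<open>Primitives in $W^{1,1}$\<close>

lemma integrable_lebesgue01_iff:
  fixes f :: "real \<Rightarrow> real"
  shows "integrable lebesgue01 f \<longleftrightarrow> f absolutely_integrable_on {0..1}"
  using absolutely_integrable_on_Icc_iff_Ioo[where f = f and a = 0 and b = 1]
  by (simp add: set_integrable_def integrable_restrict_space)

lemma integrable_lebesgue01_imp_integrable_on:
  fixes f :: "real \<Rightarrow> real"
  shows "integrable lebesgue01 f \<Longrightarrow> f integrable_on {0..1}"
  by (simp add: integrable_lebesgue01_iff absolutely_integrable_on_def)

lemma integral_lebesgue01_eq:
  fixes f :: "real \<Rightarrow> real"
  shows "integrable lebesgue01 f \<Longrightarrow> integral\<^sup>L lebesgue01 f = integral {0..1} f"
  by (simp add: lebesgue_integral_eq_integral integral_open_interval_real)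

lemma integrable_lebesgue01_continuous:
  fixes f :: "real \<Rightarrow> real"
  shows "continuous_on {0..1} f \<Longrightarrow> integrable lebesgue01 f"
  by (simp add: integrable_lebesgue01_iff absolutely_integrable_continuous_real)

lemma AE_lebesgue01_finite:
  assumes "finite S"
  shows "AE x in lebesgue01. x \<notin> S"
proof -
  have "AE x in lebesgue. x \<notin> S"
    using assms by (intro AE_not_in) (simp add: negligible_finite flip: negligible_iff_null_sets)
  then show ?thesis by (simp add: AE_restrict_space_iff eventually_mono)
qed

lemma abs_I_op_le:
  assumes f: "integrable lebesgue01 f" and r: "0 \<le> r"
  shows "\<bar>I_op f r\<bar> \<le> (LINT x|lebesgue01. \<bar>f x\<bar>)"
proof -
  note i = integrable_lebesgue01_imp_integrable_on
  have i1: "f integrable_on {r..1}" "(\<lambda>x. \<bar>f x\<bar>) integrable_on {r..1}"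
    using r f by (auto intro!: integrable_on_subinterval[OF i, of _ r 1])
  have "\<bar>I_op f r\<bar> \<le> integral {r..1} (\<lambda>x. \<bar>f x\<bar>)"
    unfolding I_op_def using integral_norm_bound_integral[OF i1] by simp
  also have "\<dots> \<le> integral {0..1} (\<lambda>x. \<bar>f x\<bar>)"
    using r f i1 by (intro integral_subset_le i) auto
  finally show ?thesis using f by (simp add: integral_lebesgue01_eq)
qed

lemma continuous_on_I_op:
  "f integrable_on {0..1} \<Longrightarrow> continuous_on {0..1} (I_op f)"
  unfolding I_op_def[abs_def] by (rule indefinite_integral_continuous_1')

text \<open>The product of \<open>I_op f\<close> and \<phi> vanishes at both ends because \<phi> has
  its support inside the open interval, so the integral of its derivative is 0. The sign is positive
  because \<open>I_op f\<close> has derivative - f.\<close>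

lemma integral_by_parts_I_op:
  assumes f: "integrable lebesgue01 f" and S: "finite S" "\<And>x. x \<in> {0<..<1} - S \<Longrightarrow> isCont f x"
    and t: "test_function \<phi> \<phi>'"
  shows "(LINT x|lebesgue01. I_op f x * \<phi>' x) = (LINT x|lebesgue01. f x * \<phi> x)"
proof -
  note fi = integrable_lebesgue01_imp_integrable_on[OF f]
  note c = continuous_on_I_op[OF fi]
  note tc = test_function_continuous[OF t]
  have d\<phi>: "(\<phi> has_real_derivative \<phi>' x) (at x)" for x
    using t by (simp add: test_function_def)
  have ends: "\<phi> 0 = 0" "\<phi> 1 = 0"
    using t closure_subset[of "{x. \<phi> x \<noteq> 0}"] by (auto simp: test_function_def)
  have "((\<lambda>x. - f x * \<phi> x + \<phi>' x * I_op f x) has_integral (I_op f 1 * \<phi> 1 - I_op f 0 * \<phi> 0)) {0..1}"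
  proof (rule fundamental_theorem_of_calculus_interior_strong[OF S(1)])
    show "continuous_on {0..1} (\<lambda>x. I_op f x * \<phi> x)"
      by (intro continuous_intros c continuous_on_subset[OF tc(1)]) auto
    fix x assume x: "x \<in> {0<..<1} - S"
    have "(I_op f has_real_derivative - f x) (at x within {0..1})"
      using x S(2)[OF x] fi by (intro has_real_derivative_I_op) (auto intro: continuous_at_imp_continuous_at_within)
    then have "(I_op f has_real_derivative - f x) (at x)"
      using x by (simp add: at_within_unit_interval)
    from DERIV_mult[OF this d\<phi>]
    show "((\<lambda>x. I_op f x * \<phi> x) has_vector_derivative - f x * \<phi> x + \<phi>' x * I_op f x) (at x)"
      by (simp add: has_real_derivative_iff_has_vector_derivative)
  qed simp
  then have 0: "integral {0..1} (\<lambda>x. - f x * \<phi> x + \<phi>' x * I_op f x) = 0"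
    using ends by (simp add: integral_unique)
  have i: "integrable lebesgue01 (\<lambda>x. f x * \<phi> x)" "integrable lebesgue01 (\<lambda>x. I_op f x * \<phi>' x)"
    using f integrable_lebesgue01_continuous[OF c] tc by (auto intro: integrable_mult_continuous)
  have "(LINT x|lebesgue01. I_op f x * \<phi>' x - f x * \<phi> x) = integral {0..1} (\<lambda>x. I_op f x * \<phi>' x - f x * \<phi> x)"
    using i by (intro integral_lebesgue01_eq) auto
  also have "\<dots> = 0" using 0 by (simp add: algebra_simps)
  finally show ?thesis using i by simp
qed

section \<open>Calculus with representatives of \<open>L1\<close> classes\<close>

lemma represents_L1_abs: "integrable lebesgue01 f \<Longrightarrow> represents_L1 f (abs_L1 f)"
  by (simp add: represents_L1_def)

lemma represents_L1_unique: "represents_L1 f u \<Longrightarrow> represents_L1 f v \<Longrightarrow> u = v"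
  by (simp add: represents_L1_def)

lemma represents_L1_cong:
  assumes "represents_L1 f u" "\<And>x. x \<in> {0<..<1} \<Longrightarrow> f x = g x"
  shows "represents_L1 g u"
proof -
  have "integrable lebesgue01 g \<longleftrightarrow> integrable lebesgue01 f"
    using assms(2) by (intro Bochner_Integration.integrable_cong) auto
  moreover have "AE x in lebesgue01. f x = g x"
    using assms(2) by (intro AE_I2) auto
  ultimately show ?thesis
    using assms(1) by (auto simp: represents_L1_iff elim: eventually_elim2)
qed

lemma represents_L1_add:
  assumes "represents_L1 f u" "represents_L1 g v"
  shows "represents_L1 (\<lambda>x. f x + g x) (u + v)"
  using assms rep_L1_add[of u v] unfolding represents_L1_iff by auto

lemma represents_L1_scaleR:
  assumes "represents_L1 f u"
  shows "represents_L1 (\<lambda>x. c * f x) (c *\<^sub>R u)"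
  using assms rep_L1_scaleR[of c u] unfolding represents_L1_iff by auto

lemma represents_L1_diff:
  assumes "represents_L1 f u" "represents_L1 g v"
  shows "represents_L1 (\<lambda>x. f x - g x) (u - v)"
  using represents_L1_add[OF assms(1) represents_L1_scaleR[OF assms(2), of "- 1"]] by simp

lemma norm_represents_L1:
  assumes "represents_L1 f u"
  shows "norm u = (LINT x|lebesgue01. \<bar>f x\<bar>)"
  using assms norm_L1.abs_eq[of f] by (auto simp: represents_L1_def L1_rel_refl)

lemma LINT_represents_L1:
  assumes "represents_L1 f u" "continuous_on UNIV \<phi>"
  shows "(LINT x|lebesgue01. rep_L1 u x * \<phi> x) = (LINT x|lebesgue01. f x * \<phi> x)"
proof (rule integral_cong_AE)
  show "AE x in lebesgue01. rep_L1 u x * \<phi> x = f x * \<phi> x"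
    using represents_L1_AE[OF assms(1)] by (auto elim: eventually_mono)
qed (use assms in \<open>auto intro!: borel_measurable_integrable integrable_mult_continuous 
       integrable_rep_L1 simp: represents_L1_def\<close>)

definition primitive_W11 :: "(real \<Rightarrow> real) \<Rightarrow> W11" where
  "primitive_W11 f = Abs_W11 (abs_L1 (I_op f))"

text \<open>A finite exceptional set is all that the fundamental theorem of calculus tolerates here; the
  integrands in question are discontinuous only at the finitely many zeros of \<open>J h\<close>.\<close>

definition L1_pw_continuous :: "(real \<Rightarrow> real) \<Rightarrow> bool" where
  "L1_pw_continuous f \<longleftrightarrow> integrable lebesgue01 f \<and>
     (\<exists>S. finite S \<and> (\<forall>x\<in>{0<..<1} - S. isCont f x))"

lemma L1_pw_continuous_integrable: "L1_pw_continuous f \<Longrightarrow> integrable lebesgue01 f"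
  by (simp add: L1_pw_continuous_def)

lemma L1_pw_continuous_integrable_on: "L1_pw_continuous f \<Longrightarrow> f integrable_on {0..1}"
  by (intro integrable_lebesgue01_imp_integrable_on L1_pw_continuous_integrable)

lemma L1_pw_continuous_add:
  assumes "L1_pw_continuous f" "L1_pw_continuous g"
  shows "L1_pw_continuous (\<lambda>x. f x + g x)"
proof -
  obtain S T where "finite S" "\<forall>x\<in>{0<..<1} - S. isCont f x" "finite T" "\<forall>x\<in>{0<..<1} - T. isCont g x"
    using assms unfolding L1_pw_continuous_def by blast
  then have "finite (S \<union> T) \<and> (\<forall>x\<in>{0<..<1} - (S \<union> T). isCont (\<lambda>x. f x + g x) x)"
    by auto
  then show ?thesis using assms unfolding L1_pw_continuous_def by auto
qed

lemma L1_pw_continuous_cmult: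
  "L1_pw_continuous f \<Longrightarrow> L1_pw_continuous (\<lambda>x. c * f x)"
  unfolding L1_pw_continuous_def by auto

lemma L1_pw_continuous_diff:
  "L1_pw_continuous f \<Longrightarrow> L1_pw_continuous g \<Longrightarrow> L1_pw_continuous (\<lambda>x. f x - g x)"
  using L1_pw_continuous_add[of f "\<lambda>x. (- 1) * g x"] L1_pw_continuous_cmult[of g "- 1"] by simp

lemma L1_pw_continuous_continuous:
  assumes f: "continuous_on {0..1} f"
  shows "L1_pw_continuous f"
proof -
  have "isCont f x" if "x \<in> {0<..<1}" for x
    using continuous_on_interior[OF f] that by simp
  then show ?thesis
    using integrable_lebesgue01_continuous[OF f] by (auto simp: L1_pw_continuous_def)
qed

lemma integrable_I_op:
  "f integrable_on {0..1} \<Longrightarrow> integrable lebesgue01 (I_op f)"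
  by (intro integrable_lebesgue01_continuous continuous_on_I_op)

context
  fixes f :: "real \<Rightarrow> real"
  assumes f: "L1_pw_continuous f"
begin

lemma weak_deriv_I_op: "weak_deriv (abs_L1 (I_op f)) (- abs_L1 f)"
  unfolding weak_deriv_def
proof (intro allI impI)
  fix \<phi> \<phi>' assume t: "test_function \<phi> \<phi>'"
  note tc = test_function_continuous[OF t]
  have r: "represents_L1 (I_op f) (abs_L1 (I_op f))"
    by (intro represents_L1_abs integrable_I_op L1_pw_continuous_integrable_on f)
  have "represents_L1 (\<lambda>x. (- 1) * f x) ((- 1) *\<^sub>R abs_L1 f)"
    by (intro represents_L1_scaleR represents_L1_abs L1_pw_continuous_integrable f)
  then have r2: "represents_L1 (\<lambda>x. - f x) (- abs_L1 f)" by simp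
  have "(LINT x|lebesgue01. I_op f x * \<phi>' x) = (LINT x|lebesgue01. f x * \<phi> x)"
    using f t unfolding L1_pw_continuous_def by (blast intro: integral_by_parts_I_op)
  then show "(LINT x|lebesgue01. rep_L1 (abs_L1 (I_op f)) x * \<phi>' x) =
      - (LINT x|lebesgue01. rep_L1 (- abs_L1 f) x * \<phi> x)"
    using LINT_represents_L1[OF r tc(2)] LINT_represents_L1[OF r2 tc(1)] by simp
qed

lemma Rep_primitive_W11: "Rep_W11 (primitive_W11 f) = abs_L1 (I_op f)"
  unfolding primitive_W11_def using weak_deriv_I_op by (intro Abs_W11_inverse) auto

lemma represents_W11_primitive: "represents_W11 (I_op f) (primitive_W11 f)"
  unfolding represents_W11_def Rep_primitive_W11
  by (intro represents_L1_abs integrable_I_op L1_pw_continuous_integrable_on f)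

text \<open>The L1 norm of f bounds |I_op f| everywhere, hence also its integral over an interval of
  length 1, and it equals the norm of the weak derivative. Estimates in \<open>W11\<close> thereby
  reduce to integrals of |f|.\<close>

lemma norm_primitive_W11_le: "norm (primitive_W11 f) \<le> 2 * (LINT x|lebesgue01. \<bar>f x\<bar>)"
proof -
  note fi = L1_pw_continuous_integrable[OF f]
  note Ii = integrable_I_op[OF L1_pw_continuous_integrable_on[OF f]]
  have "norm (Rep_W11 (primitive_W11 f)) = (LINT x|lebesgue01. \<bar>I_op f x\<bar>)"
    using represents_W11_primitive by (simp add: represents_W11_def norm_represents_L1)
  also have "\<dots> \<le> (LINT x|lebesgue01. (LINT x|lebesgue01. \<bar>f x\<bar>))"
    using fi Ii integrable_lebesgue01_continuous[of "\<lambda>_. LINT x|lebesgue01. \<bar>f x\<bar>"]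
    by (intro integral_mono) (auto intro: abs_I_op_le)
  also have "\<dots> = (LINT x|lebesgue01. \<bar>f x\<bar>)"
    by (subst integral_lebesgue01_eq) (auto intro!: integrable_lebesgue01_continuous continuous_intros)
  finally have "norm (Rep_W11 (primitive_W11 f)) \<le> (LINT x|lebesgue01. \<bar>f x\<bar>)" .
  moreover have "norm (W11_deriv (primitive_W11 f)) = (LINT x|lebesgue01. \<bar>f x\<bar>)"
    unfolding W11_deriv.rep_eq Rep_primitive_W11 L1_weak_deriv_eq[OF weak_deriv_I_op] norm_minus_cancel
    by (rule norm_represents_L1[OF represents_L1_abs[OF fi]])
  ultimately show ?thesis by (simp add: norm_W11_def)
qed

end

text \<open>Identities in \<open>W11\<close> are proved below by exhibiting a common representative,
  as \<open>C1_eqI\<close> does pointwise in \<open>C1\<close>.\<close>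

lemma represents_W11_unique: "represents_W11 f u \<Longrightarrow> represents_W11 f v \<Longrightarrow> u = v"
  unfolding represents_W11_def using represents_L1_unique Rep_W11_inject by blast

lemma represents_W11_cong:
  "represents_W11 f u \<Longrightarrow> (\<And>x. x \<in> {0<..<1} \<Longrightarrow> f x = g x) \<Longrightarrow> represents_W11 g u"
  unfolding represents_W11_def by (rule represents_L1_cong)

lemma primitive_W11_cong:
  assumes "L1_pw_continuous f" "L1_pw_continuous g" "\<And>x. x \<in> {0..1} \<Longrightarrow> f x = g x"
  shows "primitive_W11 f = primitive_W11 g"
proof (rule represents_W11_unique)
  show "represents_W11 (I_op g) (primitive_W11 f)"
    by (rule represents_W11_cong[OF represents_W11_primitive[OF assms(1)]])
      (auto intro!: I_op_cong assms(3))
qed (rule represents_W11_primitive[OF assms(2)])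

lemma primitive_W11_add:
  assumes "L1_pw_continuous f" "L1_pw_continuous g"
  shows "primitive_W11 (\<lambda>s. f s + g s) = primitive_W11 f + primitive_W11 g"
proof (rule represents_W11_unique)
  show "represents_W11 (I_op (\<lambda>s. f s + g s)) (primitive_W11 (\<lambda>s. f s + g s))"
    by (intro represents_W11_primitive L1_pw_continuous_add assms)
  have "represents_W11 (\<lambda>r. I_op f r + I_op g r) (primitive_W11 f + primitive_W11 g)"
    using assms[THEN represents_W11_primitive]
    unfolding represents_W11_def plus_W11.rep_eq by (rule represents_L1_add)
  then show "represents_W11 (I_op (\<lambda>s. f s + g s)) (primitive_W11 f + primitive_W11 g)"
    by (rule represents_W11_cong) (simp add: I_op_add L1_pw_continuous_integrable_on assms)
qed

lemma primitive_W11_scaleR: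
  assumes "L1_pw_continuous f"
  shows "primitive_W11 (\<lambda>s. c * f s) = c *\<^sub>R primitive_W11 f"
proof (rule represents_W11_unique)
  show "represents_W11 (I_op (\<lambda>s. c * f s)) (primitive_W11 (\<lambda>s. c * f s))"
    by (intro represents_W11_primitive L1_pw_continuous_cmult assms)
  have "represents_W11 (\<lambda>r. c * I_op f r) (c *\<^sub>R primitive_W11 f)"
    using assms[THEN represents_W11_primitive]
    unfolding represents_W11_def scaleR_W11.rep_eq by (rule represents_L1_scaleR)
  then show "represents_W11 (I_op (\<lambda>s. c * f s)) (c *\<^sub>R primitive_W11 f)"
    by (rule represents_W11_cong) (simp add: I_op_cmult)
qed

lemma primitive_W11_diff:
  assumes "L1_pw_continuous f" "L1_pw_continuous g"
  shows "primitive_W11 (\<lambda>s. f s - g s) = primitive_W11 f - primitive_W11 g"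
  using primitive_W11_add[of "\<lambda>s. f s - g s" g] assms by (simp add: L1_pw_continuous_diff)

subsection \<open>The case \<open>p > 2\<close>\<close>

text \<open>A primitive of |s - z|^b is \<open>phi (b + 2) (s - z) / (b + 1)\<close>. It is
  continuous across z since b + 2 > 1, so z is an admissible exceptional point for the fundamental
  theorem of calculus. The bound does not depend on z.\<close>

lemma abs_diff_powr_integral:
  fixes b z :: real
  assumes b: "- 1 < b" and z: "z \<in> {0..1}"
  shows "integrable lebesgue01 (\<lambda>s. \<bar>s - z\<bar> powr b)"
    and "(LINT s|lebesgue01. \<bar>s - z\<bar> powr b) \<le> 2 / (b + 1)"
proof -
  define T where "T = (\<lambda>s. phi (b + 2) (s - z) / (b + 1))"
  have I: "((\<lambda>s. \<bar>s - z\<bar> powr b) has_integral (T 1 - T 0)) {0..1}"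
  proof (rule fundamental_theorem_of_calculus_interior_strong[of "{z}"])
    fix x assume "x \<in> {0<..<1} - {z}"
    then have "x - z \<noteq> 0" by simp
    moreover have "((\<lambda>s. s - z) has_real_derivative 1) (at x)"
      by (auto intro!: derivative_eq_intros)
    ultimately have "((\<lambda>s. phi (b + 2) (s - z)) has_real_derivative
        (b + 2 - 1) * \<bar>x - z\<bar> powr (b + 2 - 2) * 1) (at x)"
      by (intro DERIV_chain2[OF DERIV_phi_nonzero])
    then have "((\<lambda>s. phi (b + 2) (s - z)) has_real_derivative (b + 1) * \<bar>x - z\<bar> powr b) (at x)"
      by (simp add: algebra_simps)
    then have "(T has_real_derivative (b + 1) * \<bar>x - z\<bar> powr b / (b + 1)) (at x)"
      unfolding T_def by (rule DERIV_cdivide)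
    then show "(T has_vector_derivative \<bar>x - z\<bar> powr b) (at x)"
      using b by (simp add: has_real_derivative_iff_has_vector_derivative)
  next
    show "continuous_on {0..1} T"
      unfolding T_def using b
      by (intro continuous_intros continuous_on_compose2[OF continuous_on_phi[of "b + 2" UNIV]]) auto
  qed auto
  then show int: "integrable lebesgue01 (\<lambda>s. \<bar>s - z\<bar> powr b)"
    unfolding integrable_lebesgue01_iff
    by (intro nonnegative_absolutely_integrable_1) (auto simp: integrable_on_def)
  have "\<bar>phi (b + 2) x\<bar> \<le> 1" if "\<bar>x\<bar> \<le> 1" for x
    using that b by (simp add: abs_phi powr_le1)
  from this[of "1 - z"] this[of "0 - z"] have "phi (b + 2) (1 - z) - phi (b + 2) (0 - z) \<le> 2"
    using z by auto
  then have "T 1 - T 0 \<le> 2 / (b + 1)"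
    using b by (simp add: T_def divide_right_mono flip: diff_divide_distrib)
  then show "(LINT s|lebesgue01. \<bar>s - z\<bar> powr b) \<le> 2 / (b + 1)"
    using I by (simp add: integral_lebesgue01_eq[OF int] integral_unique)
qed

lemma borel_measurable_lebesgue01_continuous:
  fixes g :: "real \<Rightarrow> real"
  shows "continuous_on {0..1} g \<Longrightarrow> g \<in> borel_measurable lebesgue01"
  by (rule borel_measurable_integrable[OF integrable_lebesgue01_continuous])

text \<open>There are n possible centres, each contributing 2 / (b + 1). The value depends on the
  function only through \<kappa> and n, so it is shared by a whole ball around h0.\<close>

definition weight_bound :: "real \<Rightarrow> nat \<Rightarrow> real \<Rightarrow> real" where
  "weight_bound \<kappa> n b = \<kappa> powr b * (real n * (2 / (b + 1)))"

context
  fixes g :: "real \<Rightarrow> real" and \<kappa> :: real and n :: nat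
  assumes g: "continuous_on {0..1} g" and k: "0 < \<kappa>" and lv: "linearly_vanishing \<kappa> n g"
begin

lemma finite_zeros: "finite {s \<in> {0..1}. g s = 0}"
proof -
  obtain z where "\<forall>s\<in>{0..1}. \<exists>i<n. \<kappa> * \<bar>s - z i\<bar> \<le> \<bar>g s\<bar>"
    using lv unfolding linearly_vanishing_def by blast
  then have "{s \<in> {0..1}. g s = 0} \<subseteq> z ` {..<n}"
    using k by (fastforce simp: mult_le_0_iff)
  then show ?thesis by (rule finite_subset) simp
qed

text \<open>The index i for which the linear lower bound holds varies with s; summing over all i
  gives a majorant without any choice depending on s.\<close>

lemma abs_powr_integral:
  assumes b: "- 1 < b" "b \<le> 0"
  shows "integrable lebesgue01 (\<lambda>s. \<bar>g s\<bar> powr b)"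
    and "(LINT s|lebesgue01. \<bar>g s\<bar> powr b) \<le> weight_bound \<kappa> n b"
proof -
  obtain z where z: "\<And>i. i < n \<Longrightarrow> z i \<in> {0..1}"
    "\<And>s. s \<in> {0..1} \<Longrightarrow> \<exists>i<n. \<kappa> * \<bar>s - z i\<bar> \<le> \<bar>g s\<bar>"
    using lv unfolding linearly_vanishing_def by blast
  define B where "B = (\<lambda>s. \<kappa> powr b * (\<Sum>i<n. \<bar>s - z i\<bar> powr b))"
  note zi = abs_diff_powr_integral[OF b(1) z(1)]
  have B: "integrable lebesgue01 B"
    unfolding B_def by (intro integrable_mult_right Bochner_Integration.integrable_sum zi) auto
  \<comment> \<open>The centres are excluded because \<open>powr\<close> gives 0 instead of infinity
    there, so the majorant may be too small at these finitely many points.\<close>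
  have le: "\<bar>g s\<bar> powr b \<le> B s" if s: "s \<in> {0..1}" "s \<notin> z ` {..<n}" for s
  proof -
    obtain i where i: "i < n" "\<kappa> * \<bar>s - z i\<bar> \<le> \<bar>g s\<bar>" using z(2) s by blast
    have "s \<noteq> z i" using i s by auto
    then have "0 < \<kappa> * \<bar>s - z i\<bar>" using k by simp
    then have "\<bar>g s\<bar> powr b \<le> (\<kappa> * \<bar>s - z i\<bar>) powr b"
      using i b by (intro powr_mono2') auto
    also have "\<dots> = \<kappa> powr b * \<bar>s - z i\<bar> powr b" using k by (simp add: powr_mult)
    also have "\<bar>s - z i\<bar> powr b \<le> (\<Sum>i<n. \<bar>s - z i\<bar> powr b)"
      using i by (intro member_le_sum) auto
    finally show ?thesis by (simp add: B_def mult_left_mono)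
  qed
  have AE: "AE s in lebesgue01. \<bar>g s\<bar> powr b \<le> B s"
    using AE_lebesgue01_finite[OF finite_imageI[OF finite_lessThan], of z n]
    by (rule AE_mp) (auto intro!: AE_I2 le)
  show int: "integrable lebesgue01 (\<lambda>s. \<bar>g s\<bar> powr b)"
  proof (rule Bochner_Integration.integrable_bound[OF B])
    show "(\<lambda>s. \<bar>g s\<bar> powr b) \<in> borel_measurable lebesgue01"
      using borel_measurable_lebesgue01_continuous[OF g] by measurable
    show "AE s in lebesgue01. norm (\<bar>g s\<bar> powr b) \<le> norm (B s)"
      using AE by eventually_elim (auto simp: B_def sum_nonneg)
  qed
  have "(LINT s|lebesgue01. \<bar>g s\<bar> powr b) \<le> (LINT s|lebesgue01. B s)"
    using int B AE by (rule integral_mono_AE)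
  also have "\<dots> = \<kappa> powr b * (\<Sum>i<n. LINT s|lebesgue01. \<bar>s - z i\<bar> powr b)"
    unfolding B_def by (subst integral_mult_right_zero, subst Bochner_Integration.integral_sum) (auto intro: zi)
  also have "\<dots> \<le> \<kappa> powr b * (\<Sum>i<n. 2 / (b + 1))"
    by (intro mult_left_mono sum_mono zi) auto
  finally show "(LINT s|lebesgue01. \<bar>g s\<bar> powr b) \<le> weight_bound \<kappa> n b"
    by (simp add: weight_bound_def)
qed

text \<open>Positive centres keep a fixed distance from 0. For s below half of it, every centre,
  including one at 0, is at least s away from s.\<close>

lemma eventually_linear_lower_bound_0:
  "\<forall>\<^sub>F s in at 0 within {0..1}. \<kappa> * s \<le> \<bar>g s\<bar>"
proof -
  obtain z where z: "\<And>i. i < n \<Longrightarrow> z i \<in> {0..1}"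
    "\<And>s. s \<in> {0..1} \<Longrightarrow> \<exists>i<n. \<kappa> * \<bar>s - z i\<bar> \<le> \<bar>g s\<bar>"
    using lv unfolding linearly_vanishing_def by blast
  \<comment> \<open>The element 1 makes the set nonempty, so that \<open>Min\<close> is defined even
    if no centre is positive.\<close>
  define P where "P = insert 1 {z i |i. i < n \<and> 0 < z i}"
  have P: "finite P" by (simp add: P_def)
  have pos: "0 < Min P" using P by (subst Min_gr_iff) (auto simp: P_def)
  have "\<kappa> * s \<le> \<bar>g s\<bar>" if s: "s \<in> {0..1}" "s < Min P / 2" for s
  proof -
    obtain i where i: "i < n" "\<kappa> * \<bar>s - z i\<bar> \<le> \<bar>g s\<bar>" using z(2) s by blast
    have "s \<le> \<bar>s - z i\<bar>"
    proof (cases "0 < z i")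
      case True
      then have "Min P \<le> z i" using P i by (intro Min_le) (auto simp: P_def)
      then show ?thesis using s by auto
    next
      case False
      then show ?thesis using z(1)[OF i(1)] s by auto
    qed
    then show ?thesis using i k mult_left_mono[of s "\<bar>s - z i\<bar>" \<kappa>] by linarith
  qed
  then show ?thesis using pos unfolding eventually_at
    by (intro exI[of _ "Min P / 2"]) auto
qed

end

section \<open>Continuous differentiability of the solution operator into \<open>W11\<close>\<close>

lemma Holder_imp_continuous_on:
  fixes f :: "'a::real_normed_vector \<Rightarrow> 'b::real_normed_vector"
  assumes "0 < \<theta>" "\<And>x y. x \<in> V \<Longrightarrow> y \<in> V \<Longrightarrow> norm (f x - f y) \<le> C * norm (x - y) powr \<theta>"
  shows "continuous_on V f"
  unfolding continuous_on_def
proof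
  fix x assume x: "x \<in> V"
  have "((\<lambda>y. C * norm (y - x) powr \<theta>) \<longlongrightarrow> C * norm (x - x) powr \<theta>) (at x within V)"
    using assms(1) by (intro tendsto_intros tendsto_powr') auto
  then have "((\<lambda>y. C * norm (y - x) powr \<theta>) \<longlongrightarrow> 0) (at x within V)" using assms(1) by simp
  moreover have "\<forall>\<^sub>F y in at x within V. norm (f y - f x) \<le> C * norm (y - x) powr \<theta>"
    unfolding eventually_at_filter by (rule always_eventually) (use assms(2) x in blast)
  ultimately have "((\<lambda>y. f y - f x) \<longlongrightarrow> 0) (at x within V)"
    by (rule Lim_null_comparison[rotated])
  then show "(f \<longlongrightarrow> f x) (at x within V)" by (rule LIM_zero_cancel)
qed

definition S_W11 :: "nat \<Rightarrow> real \<Rightarrow> C0 \<Rightarrow> W11" where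
  "S_W11 N q h = primitive_W11 (\<lambda>s. phi q (J N (C0_fun h) s))"

text \<open>Used only for h in the ball around h0 fixed below, where the integrand is integrable and
  the map in \<open>hb\<close> is shown to be bounded and linear.\<close>

definition DS_W11 :: "nat \<Rightarrow> real \<Rightarrow> C0 \<Rightarrow> C0 \<Rightarrow>\<^sub>L W11" where
  "DS_W11 N q h = Blinfun (\<lambda>hb. primitive_W11 (DS_integrand N q h hb))"

definition weight_L1 :: "nat \<Rightarrow> real \<Rightarrow> C0 \<Rightarrow> L1" where
  "weight_L1 N q h = abs_L1 (\<lambda>s. \<bar>J N (C0_fun h) s\<bar> powr (q - 2))"

context
  fixes N :: nat and q :: real and h0 :: C0 and \<kappa> e :: real and n :: nat
  assumes q: "1 < q" "q < 2" and k: "0 < \<kappa>"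
    and lv: "\<forall>h\<in>ball h0 e. linearly_vanishing \<kappa> n (J N (C0_fun h))"
begin

lemmas linearly_vanishing_J = bspec[OF lv]

lemmas J_powr_integrable = abs_powr_integral(1)[OF continuous_on_J_C0 k linearly_vanishing_J]
lemmas J_powr_integral_le = abs_powr_integral(2)[OF continuous_on_J_C0 k linearly_vanishing_J]

lemma weight_integral_diff_le:
  assumes h: "h \<in> ball h0 e" "h' \<in> ball h0 e"
  shows "(LINT s|lebesgue01. \<bar>\<bar>J N (C0_fun h) s\<bar> powr (q - 2) - \<bar>J N (C0_fun h') s\<bar> powr (q - 2)\<bar>)
    \<le> 2 * weight_bound \<kappa> n ((q - 3) / 2) * norm (h - h') powr ((q - 1) / 2)"
proof -
  \<comment> \<open>With this choice q - 2 - \<theta> is (q - 3) / 2, the midpoint of -1 and q - 2,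
    hence still an integrable exponent.\<close>
  define \<theta> where "\<theta> = (q - 1) / 2"
  have \<theta>: "0 < \<theta>" "\<theta> \<le> 1" and b: "q - 2 - \<theta> = (q - 3) / 2" "- 1 < (q - 3) / 2" "(q - 3) / 2 \<le> 0"
    using q by (auto simp: \<theta>_def field_simps)
  let ?D = "\<lambda>s. \<bar>\<bar>J N (C0_fun h) s\<bar> powr (q - 2) - \<bar>J N (C0_fun h') s\<bar> powr (q - 2)\<bar>"
  let ?B = "\<lambda>s. \<bar>J N (C0_fun h) s\<bar> powr ((q - 3) / 2) + \<bar>J N (C0_fun h') s\<bar> powr ((q - 3) / 2)"
  have "(LINT s|lebesgue01. ?D s) \<le> (LINT s|lebesgue01. norm (h - h') powr \<theta> * ?B s)"
  proof (rule integral_mono)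
    show "integrable lebesgue01 ?D"
      using q J_powr_integrable[OF h(1), of "q - 2"] J_powr_integrable[OF h(2), of "q - 2"] by auto
    show "integrable lebesgue01 (\<lambda>s. norm (h - h') powr \<theta> * ?B s)"
      using J_powr_integrable[OF h(1) b(2,3)] J_powr_integrable[OF h(2) b(2,3)] by auto
    fix s assume "s \<in> space lebesgue01"
    then have s: "0 \<le> s" "s \<le> 1" by auto
    have "?D s \<le> \<bar>J N (C0_fun h) s - J N (C0_fun h') s\<bar> powr \<theta> * ?B s"
      using abs_powr_diff_le_Holder[of "q - 2" \<theta>, unfolded b(1)] q \<theta> by auto
    also have "\<dots> \<le> norm (h - h') powr \<theta> * ?B s"
      using abs_J_C0_le_norm[OF s, of N "h - h'"] \<theta> s
      by (intro mult_right_mono powr_mono2) (auto simp: J_C0_diff)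
    finally show "?D s \<le> norm (h - h') powr \<theta> * ?B s" .
  qed
  also have "\<dots> = norm (h - h') powr \<theta> * (LINT s|lebesgue01. ?B s)" by simp
  also have "\<dots> \<le> norm (h - h') powr \<theta> * (weight_bound \<kappa> n ((q - 3) / 2) + weight_bound \<kappa> n ((q - 3) / 2))"
    using J_powr_integrable[OF h(1) b(2,3)] J_powr_integrable[OF h(2) b(2,3)] 
      J_powr_integral_le[OF h(1) b(2,3)] J_powr_integral_le[OF h(2) b(2,3)]
    by (intro mult_left_mono) (auto simp del: times_divide_eq_right)
  finally show ?thesis by (simp add: \<theta>_def mult_ac)
qed

lemma continuous_on_weight_L1: "continuous_on (ball h0 e) (weight_L1 N q)"
proof (rule Holder_imp_continuous_on)
  fix h h' assume h: "h \<in> ball h0 e" "h' \<in> ball h0 e"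
  have "represents_L1 (\<lambda>s. \<bar>J N (C0_fun h) s\<bar> powr (q - 2) - \<bar>J N (C0_fun h') s\<bar> powr (q - 2))
    (weight_L1 N q h - weight_L1 N q h')"
    unfolding weight_L1_def using q 
    by (intro represents_L1_diff represents_L1_abs J_powr_integrable h) auto
  then show "norm (weight_L1 N q h - weight_L1 N q h') \<le> 2 * weight_bound \<kappa> n ((q - 3) / 2) * norm (h - h') powr ((q - 1) / 2)"
    using weight_integral_diff_le[OF h] by (simp add: norm_represents_L1)
qed (use q in auto)

lemma DS_integrand_bound:
  assumes "h \<in> ball h0 e"
  shows "integrable lebesgue01 (DS_integrand N q h hb)"
    "(LINT s|lebesgue01. \<bar>DS_integrand N q h hb s\<bar>) \<le> (q - 1) * weight_bound \<kappa> n (q - 2) * norm hb"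
proof -
  have b: "- 1 < q - 2" "q - 2 \<le> 0" using q by auto
  let ?B = "\<lambda>s. (q - 1) * norm hb * \<bar>J N (C0_fun h) s\<bar> powr (q - 2)"
  have B: "integrable lebesgue01 ?B"
    using J_powr_integrable[OF assms b] by simp
  have le: "\<bar>DS_integrand N q h hb s\<bar> \<le> ?B s" if s: "s \<in> {0..1}" for s
  proof -
    have "\<bar>DS_integrand N q h hb s\<bar> = (q - 1) * \<bar>J N (C0_fun h) s\<bar> powr (q - 2) * \<bar>J N (C0_fun hb) s\<bar>"
      using q by (simp add: DS_integrand_def abs_mult)
    also have "\<dots> \<le> (q - 1) * \<bar>J N (C0_fun h) s\<bar> powr (q - 2) * norm hb"
      using q s by (intro mult_left_mono abs_J_C0_le_norm) auto
    finally show ?thesis by (simp add: mult_ac)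
  qed
  show int: "integrable lebesgue01 (DS_integrand N q h hb)"
  proof (rule Bochner_Integration.integrable_bound[OF B])
    show "DS_integrand N q h hb \<in> borel_measurable lebesgue01"
      using borel_measurable_lebesgue01_continuous[OF continuous_on_J_C0[of N h]]
        borel_measurable_lebesgue01_continuous[OF continuous_on_J_C0[of N hb]]
      unfolding DS_integrand_def[abs_def] by measurable
    show "AE s in lebesgue01. norm (DS_integrand N q h hb s) \<le> norm (?B s)"
      using le by (intro AE_I2) (fastforce intro: order_trans[OF _ abs_ge_self])
  qed
  have "(LINT s|lebesgue01. \<bar>DS_integrand N q h hb s\<bar>) \<le> (LINT s|lebesgue01. ?B s)"
    using int B le by (intro integral_mono) auto
  also have "\<dots> = (q - 1) * norm hb * (LINT s|lebesgue01. \<bar>J N (C0_fun h) s\<bar> powr (q - 2))" by simp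
  also have "\<dots> \<le> (q - 1) * norm hb * weight_bound \<kappa> n (q - 2)"
    using q by (intro mult_left_mono J_powr_integral_le[OF assms b]) auto
  finally show "(LINT s|lebesgue01. \<bar>DS_integrand N q h hb s\<bar>) \<le> (q - 1) * weight_bound \<kappa> n (q - 2) * norm hb"
    by (simp add: mult_ac)
qed

lemma L1_pw_continuous_DS_integrand:
  assumes h: "h \<in> ball h0 e"
  shows "L1_pw_continuous (DS_integrand N q h hb)"
proof -
  have cJ: "isCont (J N (C0_fun k)) r" if "r \<in> {0<..<1}" for k r
    using continuous_on_interior[OF continuous_on_J_C0, of r N k] that by simp
  have "isCont (DS_integrand N q h hb) s"
    if "s \<in> {0<..<1} - {s \<in> {0..1}. J N (C0_fun h) s = 0}" for s
    unfolding DS_integrand_def[abs_def] using that by (intro continuous_intros cJ) auto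
  then show ?thesis
    unfolding L1_pw_continuous_def
    using DS_integrand_bound(1)[OF h] finite_zeros[OF continuous_on_J_C0 k linearly_vanishing_J[OF h]] by blast
qed

lemmas L1_pw_continuous_phi_J = L1_pw_continuous_continuous[OF continuous_on_phi_J[OF q(1)]]

lemma DS_W11_apply:
  assumes h: "h \<in> ball h0 e"
  shows "blinfun_apply (DS_W11 N q h) hb = primitive_W11 (DS_integrand N q h hb)"
proof -
  note c = L1_pw_continuous_DS_integrand[OF h]
  have "bounded_linear (\<lambda>hb. primitive_W11 (DS_integrand N q h hb))"
  proof (rule bounded_linear_intro)
    fix k l :: C0 and r :: real
    show "primitive_W11 (DS_integrand N q h (k + l))
      = primitive_W11 (DS_integrand N q h k) + primitive_W11 (DS_integrand N q h l)"
      by (subst primitive_W11_add[symmetric])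
        (auto intro!: primitive_W11_cong L1_pw_continuous_add c simp: DS_integrand_add)
    show "primitive_W11 (DS_integrand N q h (r *\<^sub>R k)) = r *\<^sub>R primitive_W11 (DS_integrand N q h k)"
      by (subst primitive_W11_scaleR[symmetric])
        (auto intro!: primitive_W11_cong L1_pw_continuous_cmult c simp: DS_integrand_scaleR)
    show "norm (primitive_W11 (DS_integrand N q h k)) \<le> norm k * (2 * ((q - 1) * weight_bound \<kappa> n (q - 2)))"
      using norm_primitive_W11_le[OF c, of k] DS_integrand_bound(2)[OF h, of k]
      by (simp add: mult_ac)
  qed
  then show ?thesis by (simp add: DS_W11_def bounded_linear_Blinfun_apply)
qed

text \<open>The constant is 2 from the norm of a primitive, times 3 from the pointwise remainder,
  times 2 for the weights of h and of y. The exponent exceeds 1, which is what differentiability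
  needs.\<close>

lemma norm_S_W11_remainder_le:
  assumes h: "h \<in> ball h0 e" "y \<in> ball h0 e"
  shows "norm (S_W11 N q y - S_W11 N q h - blinfun_apply (DS_W11 N q h) (y - h))
    \<le> 12 * weight_bound \<kappa> n ((q - 3) / 2) * norm (y - h) powr (1 + (q - 1) / 2)"
proof -
  define \<theta> where "\<theta> = (q - 1) / 2"
  have \<theta>: "0 < \<theta>" "\<theta> \<le> 1" and b: "q - 2 - \<theta> = (q - 3) / 2" "- 1 < (q - 3) / 2" "(q - 3) / 2 \<le> 0"
    using q by (auto simp: \<theta>_def field_simps)
  note c = L1_pw_continuous_phi_J L1_pw_continuous_DS_integrand[OF h(1)]
  let ?R = "\<lambda>s. phi q (J N (C0_fun y) s) - phi q (J N (C0_fun h) s) - DS_integrand N q h (y - h) s"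
  let ?B = "\<lambda>s. \<bar>J N (C0_fun h) s\<bar> powr ((q - 3) / 2) + \<bar>J N (C0_fun y) s\<bar> powr ((q - 3) / 2)"
  have R: "L1_pw_continuous ?R" by (intro L1_pw_continuous_diff c)
  have "S_W11 N q y - S_W11 N q h - blinfun_apply (DS_W11 N q h) (y - h) = primitive_W11 ?R"
    unfolding S_W11_def DS_W11_apply[OF h(1)] by (simp add: primitive_W11_diff L1_pw_continuous_diff c)
  also have "norm \<dots> \<le> 2 * (LINT s|lebesgue01. \<bar>?R s\<bar>)" by (rule norm_primitive_W11_le[OF R])
  also have "(LINT s|lebesgue01. \<bar>?R s\<bar>) \<le> (LINT s|lebesgue01. 3 * norm (y - h) powr (1 + \<theta>) * ?B s)"
  proof (rule integral_mono)
    show "integrable lebesgue01 (\<lambda>s. \<bar>?R s\<bar>)" using L1_pw_continuous_integrable[OF R] by simp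
    show "integrable lebesgue01 (\<lambda>s. 3 * norm (y - h) powr (1 + \<theta>) * ?B s)"
      using J_powr_integrable[OF h(1) b(2,3)] J_powr_integrable[OF h(2) b(2,3)] by auto
    fix s assume "s \<in> space lebesgue01"
    then have s: "0 \<le> s" "s \<le> 1" by auto
    have "\<bar>?R s\<bar> \<le> 3 * \<bar>J N (C0_fun y) s - J N (C0_fun h) s\<bar> powr (1 + \<theta>) * ?B s"
      using phi_remainder_le[OF q \<theta>, unfolded b(1)] s by (simp add: DS_integrand_def J_C0_diff)
    also have "\<dots> \<le> 3 * norm (y - h) powr (1 + \<theta>) * ?B s"
      using abs_J_C0_le_norm[OF s, of N "y - h"] \<theta> s
      by (intro mult_right_mono mult_left_mono powr_mono2) (auto simp: J_C0_diff)
    finally show "\<bar>?R s\<bar> \<le> 3 * norm (y - h) powr (1 + \<theta>) * ?B s" .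
  qed
  also have "\<dots> = 3 * norm (y - h) powr (1 + \<theta>) * (LINT s|lebesgue01. ?B s)" by simp
  also have "\<dots> \<le> 3 * norm (y - h) powr (1 + \<theta>) * (weight_bound \<kappa> n ((q - 3) / 2) + weight_bound \<kappa> n ((q - 3) / 2))"
    using J_powr_integrable[OF h(1) b(2,3)] J_powr_integrable[OF h(2) b(2,3)] 
      J_powr_integral_le[OF h(1) b(2,3)] J_powr_integral_le[OF h(2) b(2,3)]
    by (intro mult_left_mono) (auto simp del: times_divide_eq_right)
  finally show ?thesis by (simp add: \<theta>_def mult_ac)
qed

lemma has_derivative_S_W11:
  assumes h: "h \<in> ball h0 e"
  shows "(S_W11 N q has_derivative blinfun_apply (DS_W11 N q h)) (at h)"
proof -
  \<comment> \<open>The remainder bound requires y to lie in the ball around h0 as well, hence the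
    smaller ball around h.\<close>
  obtain d where d: "0 < d" "ball h d \<subseteq> ball h0 e"
    using h open_ball open_contains_ball_eq by blast
  let ?C = "12 * weight_bound \<kappa> n ((q - 3) / 2)"
  show ?thesis
  proof (rule has_derivativeI_sandwich[OF d(1)])
    show "bounded_linear (blinfun_apply (DS_W11 N q h))" by (rule blinfun.bounded_linear_right)
    fix y assume y: "y \<noteq> h" "dist y h < d"
    then have "y \<in> ball h0 e" using d(2) by (auto simp: dist_commute)
    from norm_S_W11_remainder_le[OF h this] y(1)
    show "norm (S_W11 N q y - S_W11 N q h - blinfun_apply (DS_W11 N q h) (y - h)) / norm (y - h)
        \<le> ?C * norm (y - h) powr ((q - 1) / 2)"
      by (simp add: pos_divide_le_eq powr_add mult_ac)
  next
    have "((\<lambda>y. ?C * norm (y - h) powr ((q - 1) / 2)) \<longlongrightarrow> ?C * norm (h - h) powr ((q - 1) / 2)) (at h)"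
      using q by (intro tendsto_intros tendsto_powr') auto
    then show "((\<lambda>y. ?C * norm (y - h) powr ((q - 1) / 2)) \<longlongrightarrow> 0) (at h)" using q by simp
  qed
qed

text \<open>The integrand is the weight times J k, and |J k| is at most norm k. The operator norm of
  a difference is thus controlled by the L1 distance of the weights, whose Hoelder bound is already
  known.\<close>

lemma continuous_on_DS_W11: "continuous_on (ball h0 e) (DS_W11 N q)"
proof (rule Holder_imp_continuous_on)
  fix h h' assume h: "h \<in> ball h0 e" "h' \<in> ball h0 e"
  let ?w = "\<lambda>s. \<bar>\<bar>J N (C0_fun h) s\<bar> powr (q - 2) - \<bar>J N (C0_fun h') s\<bar> powr (q - 2)\<bar>"
  let ?I = "LINT s|lebesgue01. ?w s"
  have w: "integrable lebesgue01 ?w"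
    using q J_powr_integrable[OF h(1), of "q - 2"] J_powr_integrable[OF h(2), of "q - 2"] by auto
  have "norm (DS_W11 N q h - DS_W11 N q h') \<le> 2 * (q - 1) * ?I"
  proof (rule norm_blinfun_bound)
    show "0 \<le> 2 * (q - 1) * ?I" using q by (intro mult_nonneg_nonneg integral_nonneg) auto
    fix k
    note c = L1_pw_continuous_DS_integrand[OF h(1), of k] L1_pw_continuous_DS_integrand[OF h(2), of k]
    have "blinfun_apply (DS_W11 N q h - DS_W11 N q h') k
      = primitive_W11 (\<lambda>s. DS_integrand N q h k s - DS_integrand N q h' k s)"
      by (simp only: primitive_W11_diff[OF c] blinfun.diff_left DS_W11_apply[OF h(1)] DS_W11_apply[OF h(2)])
    also have "norm \<dots> \<le> 2 * (LINT s|lebesgue01. \<bar>DS_integrand N q h k s - DS_integrand N q h' k s\<bar>)"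
      by (intro norm_primitive_W11_le L1_pw_continuous_diff c)
    also have "(LINT s|lebesgue01. \<bar>DS_integrand N q h k s - DS_integrand N q h' k s\<bar>)
        \<le> (LINT s|lebesgue01. (q - 1) * norm k * ?w s)"
    proof (rule integral_mono)
      show "integrable lebesgue01 (\<lambda>s. \<bar>DS_integrand N q h k s - DS_integrand N q h' k s\<bar>)"
        using c[THEN L1_pw_continuous_integrable] by simp
      show "integrable lebesgue01 (\<lambda>s. (q - 1) * norm k * ?w s)" using w by simp
      fix s assume "s \<in> space lebesgue01"
      then have s: "0 \<le> s" "s \<le> 1" by auto
      have "DS_integrand N q h k s - DS_integrand N q h' k s =
          (q - 1) * J N (C0_fun k) s * (\<bar>J N (C0_fun h) s\<bar> powr (q - 2) - \<bar>J N (C0_fun h') s\<bar> powr (q - 2))"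
        by (simp add: DS_integrand_def algebra_simps)
      also have "\<bar>\<dots>\<bar> \<le> (q - 1) * norm k * ?w s"
        unfolding abs_mult using q s by (intro mult_mono abs_J_C0_le_norm) auto
      finally show "\<bar>DS_integrand N q h k s - DS_integrand N q h' k s\<bar> \<le> (q - 1) * norm k * ?w s" .
    qed
    also have "(LINT s|lebesgue01. (q - 1) * norm k * ?w s) = (q - 1) * norm k * ?I"
      by (rule integral_mult_right_zero)
    also have "2 * ((q - 1) * norm k * ?I) = 2 * (q - 1) * ?I * norm k" by (simp only: mult_ac)
    finally show "norm (blinfun_apply (DS_W11 N q h - DS_W11 N q h') k) \<le> 2 * (q - 1) * ?I * norm k" by simp
  qed
  also have "\<dots> \<le> 2 * (q - 1) * (2 * weight_bound \<kappa> n ((q - 3) / 2) * norm (h - h') powr ((q - 1) / 2))"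
    using q by (intro mult_left_mono weight_integral_diff_le h) auto
  finally show "norm (DS_W11 N q h - DS_W11 N q h')
    \<le> 2 * (q - 1) * (2 * weight_bound \<kappa> n ((q - 3) / 2)) * norm (h - h') powr ((q - 1) / 2)"
    by (simp only: mult.assoc)
qed (use q in auto)

text \<open>Near 0 the weight is O(s^(q-2)) by the linear lower bound, and J(hb) is O(s). The
  product is O(s^(q-1)) and tends to 0, although the weight alone is unbounded there.\<close>

lemma continuous_DS_integrand_0:
  assumes h: "h \<in> ball h0 e"
  shows "continuous (at 0 within {0..1}) (DS_integrand N q h hb)"
proof -
  let ?C = "(q - 1) * \<kappa> powr (q - 2) * norm hb"
  have "((\<lambda>s::real. ?C * s powr (q - 1)) \<longlongrightarrow> ?C * 0 powr (q - 1)) (at 0 within {0..1})"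
    using q by (intro tendsto_intros tendsto_powr') (auto simp: eventually_at_filter)
  then have lim: "((\<lambda>s::real. ?C * s powr (q - 1)) \<longlongrightarrow> 0) (at 0 within {0..1})" using q by simp
  have "\<forall>\<^sub>F s in at 0 within {0..1}. norm (DS_integrand N q h hb s) \<le> ?C * s powr (q - 1)"
  proof (rule eventually_mono[OF eventually_conj])
    show "\<forall>\<^sub>F s in at 0 within {0..1}. \<kappa> * s \<le> \<bar>J N (C0_fun h) s\<bar>"
      by (rule eventually_linear_lower_bound_0[OF continuous_on_J_C0 k linearly_vanishing_J[OF h]])
    show "\<forall>\<^sub>F s in at 0 within {0..1}. s \<in> {0..1::real} \<and> s \<noteq> 0"
      by (auto simp: eventually_at_filter)
    fix s :: real assume s: "\<kappa> * s \<le> \<bar>J N (C0_fun h) s\<bar> \<and> s \<in> {0..1} \<and> s \<noteq> 0"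
    have "\<bar>J N (C0_fun h) s\<bar> powr (q - 2) \<le> (\<kappa> * s) powr (q - 2)"
      using s k q by (intro powr_mono2') auto
    also have "\<dots> = \<kappa> powr (q - 2) * s powr (q - 2)" using k s by (simp add: powr_mult)
    finally have 1: "\<bar>J N (C0_fun h) s\<bar> powr (q - 2) \<le> \<kappa> powr (q - 2) * s powr (q - 2)" .
    have "\<bar>DS_integrand N q h hb s\<bar> \<le> (q - 1) * (\<kappa> powr (q - 2) * s powr (q - 2)) * (norm hb * s)"
      unfolding DS_integrand_def abs_mult using 1 q s k
      by (intro mult_mono abs_J_C0_le) auto
    also have "\<dots> = ?C * (s powr (q - 2) * s powr 1)" using s by (simp add: mult_ac)
    also have "s powr (q - 2) * s powr 1 = s powr (q - 1)" unfolding powr_add[symmetric] by simp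
    finally show "norm (DS_integrand N q h hb s) \<le> ?C * s powr (q - 1)" by simp
  qed
  then have "(DS_integrand N q h hb \<longlongrightarrow> 0) (at 0 within {0..1})"
    by (rule Lim_null_comparison) (rule lim)
  moreover have "DS_integrand N q h hb 0 = 0" by (simp add: DS_integrand_def)
  ultimately show ?thesis by (simp add: continuous_within)
qed

end

lemma S_op_C1_degenerate:
  assumes p: "2 < p" and h0: "\<forall>r\<in>{0..1}. D01 (S_op N p h0) r = 0 \<longrightarrow> C0_fun h0 r \<noteq> 0"
  shows "\<exists>V0. open V0 \<and> h0 \<in> V0 \<and>
          (\<exists>G :: C0 \<Rightarrow> L1.
             (\<forall>h\<in>V0. represents_weight p (S_op N p h) (G h)) \<and> continuous_on V0 G) \<and>
          (\<exists>(S :: C0 \<Rightarrow> W11) (DS :: C0 \<Rightarrow> C0 \<Rightarrow>\<^sub>L W11).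
             (\<forall>h\<in>V0. represents_W11 (S_op N p h) (S h)) \<and>
             C1_map_on V0 S DS \<and>
             (\<forall>h\<in>V0. \<forall>hb. represents_W11 (DS_formula N p h hb) (DS h hb) \<and>
                (\<exists>v. continuous_on {0..1} v \<and> represents_W11 v (DS h hb) \<and>
                     linearised_bvp N p (S_op N p h) (C0_fun hb) v)))"
proof -
  define q where "q = p_conj p"
  have p1: "1 < p" using p by simp
  have q: "1 < q" "q < 2" using p by (auto simp: q_def p_conj_def field_simps)
  have "C0_fun h0 r \<noteq> 0" if "r \<in> {0..1}" "J N (C0_fun h0) r = 0" for r
    using h0 that p1 by (simp add: D01_S_op_eq_0_iff)
  then obtain \<kappa> e n where k: "0 < \<kappa>" and e: "0 < e"
    and lv: "\<forall>h\<in>ball h0 e. linearly_vanishing \<kappa> n (J N (C0_fun h))"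
    using J_linear_lower_bound_uniform[of N h0] by blast
  note ctx = q k lv
  show ?thesis
  proof (intro exI[of _ "ball h0 e"] conjI exI[of _ "weight_L1 N q"] exI[of _ "S_W11 N q"]
      exI[of _ "DS_W11 N q"] ballI allI)
    fix h assume h: "h \<in> ball h0 e"
    have "AE r in lebesgue01. r \<notin> {s \<in> {0..1}. J N (C0_fun h) s = 0}"
      by (intro AE_lebesgue01_finite finite_zeros[OF continuous_on_J_C0 k bspec[OF lv h]])
    then have "AE r in lebesgue01. D01 (S_op N p h) r \<noteq> 0"
      using AE_space by eventually_elim (auto simp: D01_S_op_eq_0_iff[OF p1])
    moreover have "represents_L1 (\<lambda>s. \<bar>J N (C0_fun h) s\<bar> powr (q - 2)) (weight_L1 N q h)"
      unfolding weight_L1_def using q by (intro represents_L1_abs J_powr_integrable[OF ctx h]) auto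
    then have "represents_L1 (\<lambda>r. \<bar>D01 (S_op N p h) r\<bar> powr (2 - p)) (weight_L1 N q h)"
      by (rule represents_L1_cong) (simp add: abs_D01_S_op_powr[OF p1] p_conj_exponent[OF p1] q_def)
    ultimately show "represents_weight p (S_op N p h) (weight_L1 N q h)"
      by (simp add: represents_weight_def)
    show "represents_W11 (S_op N p h) (S_W11 N q h)"
      unfolding S_W11_def S_op_eq q_def[symmetric]
      by (intro represents_W11_primitive L1_pw_continuous_phi_J[OF ctx])
    fix hb
    note c = L1_pw_continuous_DS_integrand[OF ctx h, of hb]
    \<comment> \<open>The boundary value problem speaks of point values, so a specific
      representative of the \<open>W11\<close> class is needed: the continuous one.\<close>
    let ?v = "I_op (DS_integrand N q h hb)"
    have v: "represents_W11 ?v (blinfun_apply (DS_W11 N q h) hb)"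
      unfolding DS_W11_apply[OF ctx h] by (rule represents_W11_primitive[OF c])
    then show "represents_W11 (DS_formula N p h hb) (blinfun_apply (DS_W11 N q h) hb)"
      by (rule represents_W11_cong) (simp add: DS_formula_eq[OF p1] q_def)
    note ci = L1_pw_continuous_integrable_on[OF c]
    have "linearised_bvp N p (S_op N p h) (C0_fun hb) ?v"
      using p ci continuous_DS_integrand_0[OF ctx h, of hb]
      by (intro linearised_bvp_I_op) (auto simp flip: q_def)
    then show "\<exists>v. continuous_on {0..1} v \<and> represents_W11 v (blinfun_apply (DS_W11 N q h) hb) \<and>
        linearised_bvp N p (S_op N p h) (C0_fun hb) v"
      using v continuous_on_I_op[OF ci] by blast
  next
    show "continuous_on (ball h0 e) (weight_L1 N q)" by (rule continuous_on_weight_L1[OF ctx])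
    show "C1_map_on (ball h0 e) (S_W11 N q) (DS_W11 N q)"
      unfolding C1_map_on_def using has_derivative_S_W11[OF ctx] continuous_on_DS_W11[OF ctx] by blast
  qed (use e in auto)
qed

theorem theorem7:
  fixes N :: nat
  assumes "N \<ge> 1"
  shows
    "(\<forall>p::real. 1 < p \<and> p < 2 \<longrightarrow>
       (\<exists>(S :: C0 \<Rightarrow> C1) (DS :: C0 \<Rightarrow> C0 \<Rightarrow>\<^sub>L C1).
          (\<forall>h. \<forall>r\<in>{0..1}. C1_fun (S h) r = S_op N p h r) \<and>
          C1_map_on UNIV S DS \<and>
          (\<forall>h hb. (\<forall>r\<in>{0..1}. C1_fun (DS h hb) r = DS_formula N p h hb r) \<and>
                  linearised_bvp N p (S_op N p h) (C0_fun hb) (C1_fun (DS h hb))))) \<and>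
     (\<forall>(p::real) (h0::C0).
       2 < p \<and> (\<forall>r\<in>{0..1}. D01 (S_op N p h0) r = 0 \<longrightarrow> C0_fun h0 r \<noteq> 0) \<longrightarrow>
       (\<exists>V0. open V0 \<and> h0 \<in> V0 \<and>
          (\<exists>G :: C0 \<Rightarrow> L1.
             (\<forall>h\<in>V0. represents_weight p (S_op N p h) (G h)) \<and> continuous_on V0 G) \<and>
          (\<exists>(S :: C0 \<Rightarrow> W11) (DS :: C0 \<Rightarrow> C0 \<Rightarrow>\<^sub>L W11).
             (\<forall>h\<in>V0. represents_W11 (S_op N p h) (S h)) \<and>
             C1_map_on V0 S DS \<and>
             (\<forall>h\<in>V0. \<forall>hb. represents_W11 (DS_formula N p h hb) (DS h hb) \<and>
                (\<exists>v. continuous_on {0..1} v \<and> represents_W11 v (DS h hb) \<and>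
                     linearised_bvp N p (S_op N p h) (C0_fun hb) v)))))"
  by (intro conjI allI impI; elim conjE; rule S_op_C1_singular S_op_C1_degenerate; assumption)

end
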